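(* Let $d\ge 2$ and $J\ge 2$ be integers, let $N=d^J$, let $k$ be an integer with $2\le k\le N$, and let $y\in\mathbb{R}^N$. Then the Exact Tree Projection (ETP) algorithm described in the context, applied to $(d,y,k)$, calculates the tree projection $\mathcal{P}_k(y)$ (that is, its output $\hat y$ is a minimizer of $\|z-y\|_2$ over all $z\in\mathbb{R}^N$ supported on a set in $\mathcal{T}_k$), and it requires at most $$3d^2Nk+N$$ additions/comparisons in total.
   Context: Canonical tree. The nodes are $1,\dots,N$ with $N=d^J$. Node $1$ is the root (level $0$) and has the $d-1$ children $2,\dots,d$ (level $1$). Each node $i$ with $2\le i\le d^{J-1}$ has the $d$ children $d(i-1)+1,\dots,di$. Nodes $i>d^{J-1}$ (level $J$) have no children. For $1\le j\le J$, level $j$ consists of the nodes $d^{j-1}+1,\dots,d^j$. Rooted trees and projection. A rooted tree of cardinality $k$ is a set of $k$ nodes that contains the root $1$ and contains the parent of each of its non-root nodes; $\mathcal{T}_k$ is the collection of all such sets. A vector $z$ is supported on a set in $\mathcal{T}_k$ if there is $\Omega\in\mathcal{T}_k$ with $z_i=0$ for all $i\notin\Omega$. $\mathcal{P}_k(y)$ denotes a minimizer of $\|z-y\|_2$ over all such $z$ (any one of the minimizers in case of ties). For $1\le j\le J$ let $l(j)=\min\left(\frac{d^{J+1-j}-1}{d-1},\,k-j\right)$. The ETP algorithm. Input: $d$, $y\in\mathbb{R}^N$, $k$. It maintains real numbers $F(i,l)$ and vectors $G(i,l)=(G_1(i,l),\dots,G_d(i,l))$ of nonnegative integers, together with temporary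 variables $\tilde F,\tilde G$. Loops over empty ranges do nothing. In each $\arg\max$, any maximizer may be chosen. First pass (find all optimal subtrees). (1) For $i=d^{J-1}+1,\dots,d^J$: set $F(i,0)=0$, $F(i,1)=y_i^2$. (2) For $j=J-1,J-2,\dots,1$ and for each $i=d^{j-1}+1,\dots,d^j$: set $F(i,0)=0$, $F(i,1)=y_i^2$, $G(i,0)=G(i,1)=0$. Then for $r=1,\dots,d$ in order: (a) for $l=2,\dots,\min[l(j),\,r\,l(j+1)+1]$: let $s_-=\max\{0,\,l-[(r-1)l(j+1)+1]\}$ and $s_+=\min[l-1,\,l(j+1)]$; let $\hat s\in\arg\max_{s_-\le s\le s_+}\{F(d(i-1)+r,s)+F(i,l-s)\}$; set $\tilde F(i,l)=F(d(i-1)+r,\hat s)+F(i,l-\hat s)$, set $\tilde G(i,l)=G(i,l-\hat s)$ and then overwrite its $r$-th entry by $\tilde G_r(i,l)=\hat s$; (b) for $l=2,\dots,\min[l(j),\,r\,l(j+1)+1]$: set $F(i,l)=\tilde F(i,l)$ and $G(i,l)=\tilde G(i,l)$. (3) Set $F(1,0)=0$, $F(1,1)=y_1^2$, $G(1,0)=G(1,1)=0$. Then for $r=2,\dots,d$ in order: (a) for $l=2,\dots,\min[k,\,(r-1)l(1)+1]$: let $s_-=\max\{0,\,l-[(r-2)l(1)+1]\}$ and $s_+=\min[l-1,\,l(1)]$; let $\hat s\in\arg\max_{s_-\le s\le s_+}\{F(r,s)+F(1,l-s)\}$; set $\tilde F(1,l)=F(r,\hat s)+F(1,l-\hat s)$,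 set $\tilde G(1,l)=G(1,l-\hat s)$ and then overwrite its $r$-th entry by $\tilde G_r(1,l)=\hat s$; (b) for $l=2,\dots,\min[k,\,(r-1)l(1)+1]$: set $F(1,l)=\tilde F(1,l)$ and $G(1,l)=\tilde G(1,l)$. Second pass (backtrack). Set $\tau=0\in\mathbb{R}^N$, then $\tau_1=1$ and $\Gamma_1=k$. For $j=0,1,\dots,J-1$ and each node $i$ of level $j$ (so $i=1$ if $j=0$, and $i=d^{j-1}+1,\dots,d^j$ if $j\ge1$): if $\tau_i=1$, then for $r=\max(1,2-j),\dots,d$: if $G_r(i,\Gamma_i)>0$, set $\tau_{d(i-1)+r}=1$ and $\Gamma_{d(i-1)+r}=G_r(i,\Gamma_i)$. Output: $\hat y\in\mathbb{R}^N$ with $\hat y_i=y_i\tau_i$ for $i=1,\dots,N$. Operation count. The counted operations are: in the first pass, for each evaluation of an $\arg\max$ over $s_-\le s\le s_+$, the additions used to form the candidate values $F(\cdot,s)+F(\cdot,l-s)$ (one per value of $s$) and the comparisons between candidate values used to find a maximizer (one fewer than the number of candidates); in the second pass, the comparisons $G_r(i,\Gamma_i)>0$. Index arithmetic, loop control, tests of the flag $\tau_i$, assignments (including storing the already computed maximal value in $\tilde F$), and multiplications are not counted. *)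

theory Defs
  imports "HOL-Analysis.Analysis"
begin

section \<open>The canonical tree and tree projections\<close>

text \<open>
  Nodes are the numbers \<open>1, \<dots>, d ^ J\<close>. A vector in \<open>\<real>\<^sup>N\<close>, where \<open>N = d ^ J\<close>, is a function
  \<^typ>\<open>nat \<Rightarrow> real\<close> of which only the values at \<open>1, \<dots>, N\<close> are meaningful; every notion
  below looks at these values only.
\<close>

definition children :: "nat \<Rightarrow> nat \<Rightarrow> nat \<Rightarrow> nat set" where
  "children d J i =
     (if i = 1 then {2..d}
      else if 2 \<le> i \<and> i \<le> d ^ (J - 1) then {d * (i - 1) + 1..d * i}
      else {})"

definition level_nodes :: "nat \<Rightarrow> nat \<Rightarrow> nat list" where
  "level_nodes d j = (if j = 0 then [1] else [d ^ (j - 1) + 1..<d ^ j + 1])"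

definition rooted_trees :: "nat \<Rightarrow> nat \<Rightarrow> nat \<Rightarrow> nat set set" where
  "rooted_trees d J k =
     {\<Omega>. \<Omega> \<subseteq> {1..d ^ J} \<and> card \<Omega> = k \<and> 1 \<in> \<Omega> \<and>
         (\<forall>c\<in>\<Omega>. c \<noteq> 1 \<longrightarrow> (\<exists>p\<in>\<Omega>. c \<in> children d J p))}"

definition tree_supported :: "nat \<Rightarrow> nat \<Rightarrow> nat \<Rightarrow> (nat \<Rightarrow> real) \<Rightarrow> bool" where
  "tree_supported d J k z \<longleftrightarrow>
     (\<exists>\<Omega>\<in>rooted_trees d J k. \<forall>i\<in>{1..d ^ J}. i \<notin> \<Omega> \<longrightarrow> z i = 0)"

definition is_tree_projection ::
    "nat \<Rightarrow> nat \<Rightarrow> nat \<Rightarrow> (nat \<Rightarrow> real) \<Rightarrow> (nat \<Rightarrow> real) \<Rightarrow> bool" where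
  "is_tree_projection d J k y z \<longleftrightarrow>
     is_arg_min (\<lambda>x. L2_set (\<lambda>i. x i - y i) {1..d ^ J}) (tree_supported d J k) z"

section \<open>The ETP algorithm\<close>

text \<open>
  \<open>tabF\<close>, \<open>tabG\<close> are the tables \<open>F(i, l)\<close>, \<open>G\<^sub>r(i, l)\<close> (arguments in the order \<open>i\<close>, \<open>l\<close>, \<open>r\<close>)
  and \<open>tmpF\<close>, \<open>tmpG\<close> their temporary versions; \<open>tau\<close> and \<open>Gam\<close> belong to the second pass;
  \<open>ops\<close> counts the operations performed so far.
\<close>

record etp_state =
  tabF :: "nat \<Rightarrow> nat \<Rightarrow> real"
  tabG :: "nat \<Rightarrow> nat \<Rightarrow> nat \<Rightarrow> nat"
  tmpF :: "nat \<Rightarrow> nat \<Rightarrow> real"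
  tmpG :: "nat \<Rightarrow> nat \<Rightarrow> nat \<Rightarrow> nat"
  tau :: "nat \<Rightarrow> real"
  Gam :: "nat \<Rightarrow> nat"
  ops :: nat

text \<open>
  For \<open>j > k\<close> the truncated difference is \<open>0\<close> instead of a negative number. This does not affect
  the algorithm: a loop \<open>l = 2, \<dots>, min (l(j)) (r * l(j + 1) + 1)\<close> is empty if \<open>l(j) \<le> 1\<close>, and
  \<open>l(j) \<ge> 2\<close> implies \<open>k \<ge> j + 2\<close>.
\<close>

definition ell :: "nat \<Rightarrow> nat \<Rightarrow> nat \<Rightarrow> nat \<Rightarrow> nat" where
  "ell d J k j = min ((d ^ (J + 1 - j) - 1) div (d - 1)) (k - j)"

text \<open>
  The free choice of a maximizer is modelled by a function \<open>pick\<close>, where \<open>pick i r l M\<close> is the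
  element chosen from the set \<open>M\<close> of maximizers. In one run, an \<open>argmax\<close> is evaluated at most once
  for each triple \<open>(i, r, l)\<close>, so the valid choice functions yield all possible runs.
\<close>

type_synonym choice = "nat \<Rightarrow> nat \<Rightarrow> nat \<Rightarrow> nat set \<Rightarrow> nat"

definition valid_choice :: "choice \<Rightarrow> bool" where
  "valid_choice pick \<longleftrightarrow> (\<forall>i r l M. M \<noteq> {} \<longrightarrow> pick i r l M \<in> M)"

text \<open>
  Body of the loops (a): \<open>c\<close> is the \<open>r\<close>-th child of \<open>i\<close>, and \<open>lo\<close>, \<open>hi\<close> are \<open>s\<^sub>-\<close>, \<open>s\<^sub>+\<close>.
  The two summands added to the counter are the additions and the comparisons.
\<close>

definition argmax_step ::
    "choice \<Rightarrow> nat \<Rightarrow> nat \<Rightarrow> nat \<Rightarrow> nat \<Rightarrow> nat \<Rightarrow> nat \<Rightarrow> etp_state \<Rightarrow> etp_state" where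
  "argmax_step pick i r c lo hi l st =
     (let cand = (\<lambda>s. tabF st c s + tabF st i (l - s));
          s = pick i r l {s. is_arg_max cand (\<lambda>s. s \<in> {lo..hi}) s}
      in st\<lparr>tmpF := (tmpF st)(i := (tmpF st i)(l := cand s)),
            tmpG := (tmpG st)(i := (tmpG st i)(l := (tabG st i (l - s))(r := s))),
            ops := ops st + card {lo..hi} + (card {lo..hi} - 1)\<rparr>)"

definition copy_step :: "nat \<Rightarrow> nat \<Rightarrow> etp_state \<Rightarrow> etp_state" where
  "copy_step i l st =
     st\<lparr>tabF := (tabF st)(i := (tabF st i)(l := tmpF st i l)),
        tabG := (tabG st)(i := (tabG st i)(l := tmpG st i l))\<rparr>"

definition init_leaf :: "(nat \<Rightarrow> real) \<Rightarrow> nat \<Rightarrow> etp_state \<Rightarrow> etp_state" where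
  "init_leaf y i st = st\<lparr>tabF := (tabF st)(i := (tabF st i)(0 := 0, 1 := (y i)\<^sup>2))\<rparr>"

definition init_node :: "(nat \<Rightarrow> real) \<Rightarrow> nat \<Rightarrow> etp_state \<Rightarrow> etp_state" where
  "init_node y i st =
     st\<lparr>tabF := (tabF st)(i := (tabF st i)(0 := 0, 1 := (y i)\<^sup>2)),
        tabG := (tabG st)(i := (tabG st i)(0 := (\<lambda>_. 0), 1 := (\<lambda>_. 0)))\<rparr>"

text \<open>
  Truncated subtraction in the lower bounds passed to \<^const>\<open>argmax_step\<close> below implements
  \<open>max {0, \<dots>}\<close>.
\<close>

definition inner_child_step ::
    "nat \<Rightarrow> nat \<Rightarrow> nat \<Rightarrow> choice \<Rightarrow> nat \<Rightarrow> nat \<Rightarrow> nat \<Rightarrow> etp_state \<Rightarrow> etp_state" where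
  "inner_child_step d J k pick j i r st =
     (let l' = ell d J k (j + 1);
          range = [2..<min (ell d J k j) (r * l' + 1) + 1]
      in fold (copy_step i) range
          (fold (\<lambda>l. argmax_step pick i r (d * (i - 1) + r)
                       (l - ((r - 1) * l' + 1)) (min (l - 1) l') l) range st))"

definition root_child_step ::
    "nat \<Rightarrow> nat \<Rightarrow> nat \<Rightarrow> choice \<Rightarrow> nat \<Rightarrow> etp_state \<Rightarrow> etp_state" where
  "root_child_step d J k pick r st =
     (let l' = ell d J k 1;
          range = [2..<min k ((r - 1) * l' + 1) + 1]
      in fold (copy_step 1) range
          (fold (\<lambda>l. argmax_step pick 1 r r
                       (l - ((r - 2) * l' + 1)) (min (l - 1) l') l) range st))"

definition process_leaves :: "nat \<Rightarrow> nat \<Rightarrow> (nat \<Rightarrow> real) \<Rightarrow> etp_state \<Rightarrow> etp_state" where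
  "process_leaves d J y = fold (init_leaf y) (level_nodes d J)"

definition process_inner ::
    "nat \<Rightarrow> nat \<Rightarrow> nat \<Rightarrow> (nat \<Rightarrow> real) \<Rightarrow> choice \<Rightarrow> etp_state \<Rightarrow> etp_state" where
  "process_inner d J k y pick =
     fold (\<lambda>j. fold (\<lambda>i st. fold (inner_child_step d J k pick j i) [1..<d + 1] (init_node y i st))
                 (level_nodes d j))
       (rev [1..<J])"

definition process_root ::
    "nat \<Rightarrow> nat \<Rightarrow> nat \<Rightarrow> (nat \<Rightarrow> real) \<Rightarrow> choice \<Rightarrow> etp_state \<Rightarrow> etp_state" where
  "process_root d J k y pick st = fold (root_child_step d J k pick) [2..<d + 1] (init_node y 1 st)"

definition first_pass ::
    "nat \<Rightarrow> nat \<Rightarrow> nat \<Rightarrow> (nat \<Rightarrow> real) \<Rightarrow> choice \<Rightarrow> etp_state \<Rightarrow> etp_state" where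
  "first_pass d J k y pick st =
     process_root d J k y pick (process_inner d J k y pick (process_leaves d J y st))"

definition backtrack_step :: "nat \<Rightarrow> nat \<Rightarrow> nat \<Rightarrow> etp_state \<Rightarrow> etp_state" where
  "backtrack_step d i r st =
     (let st' = st\<lparr>ops := ops st + 1\<rparr>;
          g = tabG st i (Gam st i) r
      in if g > 0
         then st'\<lparr>tau := (tau st)(d * (i - 1) + r := 1),
                  Gam := (Gam st)(d * (i - 1) + r := g)\<rparr>
         else st')"

definition second_pass :: "nat \<Rightarrow> nat \<Rightarrow> nat \<Rightarrow> etp_state \<Rightarrow> etp_state" where
  "second_pass d J k st =
     fold (\<lambda>j. fold (\<lambda>i st. if tau st i = 1
                              then fold (backtrack_step d i) [max 1 (2 - j)..<d + 1] st
                              else st)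
                 (level_nodes d j))
       [0..<J]
       (st\<lparr>tau := (\<lambda>_. 0)(1 := 1), Gam := (Gam st)(1 := k)\<rparr>)"

text \<open>
  The state \<open>st\<close> supplies the initial memory content. Apart from the counter, nothing in it is
  reset before the first pass, as the algorithm does not initialize its variables.
\<close>

definition etp_run ::
    "nat \<Rightarrow> nat \<Rightarrow> nat \<Rightarrow> (nat \<Rightarrow> real) \<Rightarrow> choice \<Rightarrow> etp_state \<Rightarrow> etp_state" where
  "etp_run d J k y pick st = second_pass d J k (first_pass d J k y pick (st\<lparr>ops := 0\<rparr>))"

definition etp_output ::
    "nat \<Rightarrow> nat \<Rightarrow> nat \<Rightarrow> (nat \<Rightarrow> real) \<Rightarrow> choice \<Rightarrow> etp_state \<Rightarrow> nat \<Rightarrow> real" where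
  "etp_output d J k y pick st i = y i * tau (etp_run d J k y pick st) i"

definition etp_ops ::
    "nat \<Rightarrow> nat \<Rightarrow> nat \<Rightarrow> (nat \<Rightarrow> real) \<Rightarrow> choice \<Rightarrow> etp_state \<Rightarrow> nat" where
  "etp_ops d J k y pick st = ops (etp_run d J k y pick st)"

end

(*
  The F-entries of a node, after its children have been merged one at a time, satisfy the Bellman
  equation: F(i, l) is the maximum of y_i^2 plus the sum of F(c, s_c) over all distributions
  1 + sum s_c = l of the size among the children c, and G(i, l) is an optimal distribution. The caps
  l(j) lose nothing, as the part of a tree in T_k below a node of level j has at most
  min (size of the full subtree) (k - j) nodes, the path to the root taking j more. Induction from
  the leaves upwards bounds the energy of each tree in T_k by F(1, k), and the set that the second
  pass traces out attains this value.

  For the operation count, the argmax for l has at most l candidates and costs at most 2 l - 1, so a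
  node of level j costs at most l(j)^2 per child; the sum over all levels is dominated by the level
  at which d^(J + 1 - j) passes k. The second pass makes one comparison per non-root node at most.
*)

theory Submission
  imports Defs
begin

text \<open>The tables start with arbitrary memory content, and each merge fills only part of a row.
  Optimality of a row is therefore split into two halves with different ranges: attainment only for
  sizes that the merged children can reach, at most \<open>card R * q + 1\<close>, and the upper
  bound for every distribution within the caps. That a complete node reaches all of
  \<open>1..l(j)\<close> is a separate inequality between consecutive caps (\<open>ell_le\<close>);
  at the root it rests on \<open>k <= N\<close>. Both optimality directions use one device: the
  number \<open>n i\<close> and the energy \<open>w i\<close> of the selected nodes below
  \<open>i\<close>, as recursive subtree sums. For an arbitrary tree the \<open>n c\<close> of the
  children are an admissible distribution, so \<open>w i\<close> is at most the entry
  \<open>F(i, n i)\<close>; for the traced set \<open>n i\<close> equals the size assigned by the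
  second pass, and equality holds. In the constant 3, one \<open>d^2 N k\<close> pays for the root,
  \<open>(d-1) k^2\<close> with \<open>k <= N\<close>. With \<open>D = d^(J+1)\<close>, the levels
  before the threshold cost at most \<open>d D k\<close> and the others at most
  \<open>2 D k <= d D k\<close>, where \<open>d D k = d^2 N k\<close>.\<close>

section \<open>The Bellman equation at a node\<close>

text \<open>
  \<open>f\<close>, \<open>g\<close> are the table rows of a node with \<open>v = y\<^sub>i\<^sup>2\<close> after the children with ranks in \<open>R\<close> have
  been merged, \<open>C r\<close> is the row of the \<open>r\<close>-th child, and \<open>L\<close>, \<open>q\<close> are the caps \<open>l(j)\<close>, \<open>l(j + 1)\<close>.
  The entry for \<open>l = 1\<close> exists even if \<open>L = 0\<close>, hence \<open>max 1 L\<close>.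
\<close>

definition node_opt ::
    "(nat \<Rightarrow> nat \<Rightarrow> real) \<Rightarrow> real \<Rightarrow> nat \<Rightarrow> nat \<Rightarrow> nat set \<Rightarrow> (nat \<Rightarrow> real) \<Rightarrow> (nat \<Rightarrow> nat \<Rightarrow> nat) \<Rightarrow> bool"
  where
  "node_opt C v L q R f g \<longleftrightarrow>
     f 0 = 0 \<and> f 1 = v \<and> g 1 = (\<lambda>_. 0) \<and>
     (\<forall>l. 1 \<le> l \<and> l \<le> max 1 L \<and> l \<le> card R * q + 1 \<longrightarrow>
        (\<forall>r\<in>R. g l r \<le> q) \<and> 1 + (\<Sum>r\<in>R. g l r) = l \<and> f l = v + (\<Sum>r\<in>R. C r (g l r))) \<and>
     (\<forall>s. (\<forall>r\<in>R. s r \<le> q) \<and> 1 + sum s R \<le> max 1 L \<longrightarrow>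
        v + (\<Sum>r\<in>R. C r (s r)) \<le> f (1 + sum s R))"

lemma node_opt_empty:
  assumes "f 0 = 0" "f 1 = v" "g 1 = (\<lambda>_. 0)"
  shows "node_opt C v L q {} f g"
  using assms by (auto simp: node_opt_def le_antisym)

text \<open>The window for \<open>s\<close> contains exactly those splits for which \<open>s\<close>
  respects the cap and the remainder \<open>l - s\<close> is a size that the old row attains. So a
  chosen split yields a valid distribution, and no admissible distribution falls outside the
  window.\<close>

lemma node_opt_insert:
  assumes opt: "node_opt C v L q R f g" and R: "finite R" "r \<notin> R" and C0: "C r 0 = 0"
    and upd: "\<And>l. 2 \<le> l \<Longrightarrow> l \<le> L \<Longrightarrow> l \<le> Suc (card R) * q + 1 \<Longrightarrow>
       is_arg_max (\<lambda>s. C r s + f (l - s)) (\<lambda>s. s \<in> {l - (card R * q + 1)..min (l - 1) q}) (sh l) \<and>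
       f' l = C r (sh l) + f (l - sh l) \<and> g' l = (g (l - sh l))(r := sh l)"
    and low: "\<And>l. l \<le> 1 \<Longrightarrow> f' l = f l \<and> g' l = g l"
  shows "node_opt C v L q (insert r R) f' g'"
proof -
  have f01: "f 0 = 0" "f 1 = v" "g 1 = (\<lambda>_. 0)" using opt by (auto simp: node_opt_def)
  have att: "(\<forall>r\<in>R. g l r \<le> q) \<and> 1 + (\<Sum>r\<in>R. g l r) = l \<and> f l = v + (\<Sum>r\<in>R. C r (g l r))"
    if "1 \<le> l" "l \<le> max 1 L" "l \<le> card R * q + 1" for l
    using opt that unfolding node_opt_def by blast
  have ub: "v + (\<Sum>r\<in>R. C r (s r)) \<le> f (1 + sum s R)"
    if "\<forall>r\<in>R. s r \<le> q" "1 + sum s R \<le> max 1 L" for s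
    using opt that unfolding node_opt_def by blast
  have card: "card (insert r R) = Suc (card R)" using R by simp
  \<comment> \<open>Overwriting the entry of the new rank is invisible to sums over the old ranks.
    The value type is polymorphic because both sizes and energies are summed.\<close>
  have sumR: "(\<Sum>x\<in>R. h x (if x = r then b else e x)) = (\<Sum>x\<in>R. h x (e x))"
    for h :: "nat \<Rightarrow> nat \<Rightarrow> 'c::comm_monoid_add" and b e
    using R by (intro sum.cong) auto
  have "(\<forall>x\<in>insert r R. g' l x \<le> q) \<and> 1 + (\<Sum>x\<in>insert r R. g' l x) = l \<and>
      f' l = v + (\<Sum>x\<in>insert r R. C x (g' l x))"
    if l: "1 \<le> l" "l \<le> max 1 L" "l \<le> card (insert r R) * q + 1" for l
  \<comment> \<open>No merge touches the entry for \<open>l = 1\<close>. Its distribution is zero at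
    the new rank too, since initialization clears all ranks.\<close>
  proof (cases "l = 1")
    case True
    have "(\<Sum>x\<in>R. C x (g 1 x)) = 0" using att[of 1] f01 by simp
    then show ?thesis using True low[of 1] f01 R C0 by simp
  next
    case False
    then have l2: "2 \<le> l" "l \<le> L" "l \<le> Suc (card R) * q + 1" using l card by auto
    note u = upd[OF l2]
    have s: "l - (card R * q + 1) \<le> sh l" "sh l \<le> l - 1" "sh l \<le> q"
      using u by (auto simp: is_arg_max_def)
    have "1 \<le> l - sh l" "l - sh l \<le> max 1 L" "l - sh l \<le> card R * q + 1"
      using s l2 by linarith+
    note a = att[OF this]
    show ?thesis using u a s l2 R
      by (auto simp: sumR[of "\<lambda>_ z. z"] sumR)
  qed
  moreover have "v + (\<Sum>x\<in>insert r R. C x (s x)) \<le> f' (1 + sum s (insert r R))"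
    if s: "\<forall>x\<in>insert r R. s x \<le> q" "1 + sum s (insert r R) \<le> max 1 L" for s
  proof (cases "sum s (insert r R) = 0")
    case True
    then have "s r = 0" "sum s R = 0" using R by auto
    then show ?thesis using ub[of s] s low[of 1] R C0 by simp
  next
    case False
    define l where "l = 1 + sum s (insert r R)"
    have lR: "l = 1 + s r + sum s R" using R l_def by simp
    have sR: "sum s R \<le> card R * q" using s sum_bounded_above[of R s q] by simp
    have "2 \<le> l" "l \<le> L" using False s l_def by auto
    moreover have "l \<le> Suc (card R) * q + 1" using lR sR s by simp
    ultimately have u: "is_arg_max (\<lambda>s. C r s + f (l - s)) (\<lambda>s. s \<in> {l - (card R * q + 1)..min (l - 1) q}) (sh l)"
       "f' l = C r (sh l) + f (l - sh l)" using upd by blast+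
    \<comment> \<open>The lower end holds because the old children take at most
      \<open>card R * q\<close> nodes together.\<close>
    have "s r \<in> {l - (card R * q + 1)..min (l - 1) q}" using s sR lR by auto
    then have "C r (s r) + f (l - s r) \<le> f' l"
      using u by (auto simp: is_arg_max_def not_less)
    moreover have "v + (\<Sum>x\<in>R. C x (s x)) \<le> f (l - s r)"
      using ub[of s] s lR l_def by auto
    ultimately show ?thesis using R l_def by simp
  qed
  ultimately show ?thesis
    unfolding node_opt_def using low[of 0] low[of 1] f01 by auto
qed

section \<open>First pass\<close>

text \<open>Naming the choice as a function of the table \<open>F\<close> provides the witness for
  \<open>sh\<close> in \<open>node_opt_insert\<close>.\<close>

definition split_choice ::
    "choice \<Rightarrow> nat \<Rightarrow> nat \<Rightarrow> nat \<Rightarrow> (nat \<Rightarrow> nat) \<Rightarrow> (nat \<Rightarrow> nat) \<Rightarrow> (nat \<Rightarrow> nat \<Rightarrow> real) \<Rightarrow> nat \<Rightarrow> nat" where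
  "split_choice pick i r c lo hi F l =
     pick i r l {s. is_arg_max (\<lambda>s. F c s + F i (l - s)) (\<lambda>s. s \<in> {lo l..hi l}) s}"

lemma split_choice_is_arg_max:
  assumes "valid_choice pick" "lo l \<le> hi l"
  shows "is_arg_max (\<lambda>s. F c s + F i (l - s)) (\<lambda>s. s \<in> {lo l..hi l}) (split_choice pick i r c lo hi F l)"
proof -
  have "\<exists>s. is_arg_max (\<lambda>s. F c s + F i (l - s)) (\<lambda>s. s \<in> {lo l..hi l}) s"
  proof -
    have ne: "finite ((\<lambda>s. F c s + F i (l - s)) ` {lo l..hi l})" "(\<lambda>s. F c s + F i (l - s)) ` {lo l..hi l} \<noteq> {}"
      using assms(2) by auto
    obtain x where x: "x \<in> {lo l..hi l}"
      "Max ((\<lambda>s. F c s + F i (l - s)) ` {lo l..hi l}) = F c x + F i (l - x)"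
      using Max_in[OF ne] by blast
    have "F c s + F i (l - s) \<le> F c x + F i (l - x)" if "s \<in> {lo l..hi l}" for s
      using Max_ge[OF ne(1), of "F c s + F i (l - s)"] that x(2) by auto
    then show ?thesis using x(1) by (auto simp: is_arg_max_def not_less)
  qed
  then have "{s. is_arg_max (\<lambda>s. F c s + F i (l - s)) (\<lambda>s. s \<in> {lo l..hi l}) s} \<noteq> {}" (is "?M \<noteq> {}")
    by simp
  from assms(1)[unfolded valid_choice_def, rule_format, OF this, of i r l] show ?thesis
    by (simp add: split_choice_def)
qed

text \<open>The steps write only the temporary rows, so every \<open>l\<close> reads the tables as
  they were before the loop. Since \<open>hi l < l\<close>, there are at most \<open>l\<close>
  candidates, hence \<open>l\<close> additions and \<open>l - 1\<close> comparisons.\<close>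

lemma fold_argmax_step:
  fixes pick i r c lo hi st
  defines "A \<equiv> \<lambda>l. argmax_step pick i r c (lo l) (hi l) l"
  assumes "distinct ls" "\<forall>l\<in>set ls. hi l < l"
  shows "tabF (fold A ls st) = tabF st" "tabG (fold A ls st) = tabG st"
    "\<forall>l\<in>set ls. tmpF (fold A ls st) i l =
       tabF st c (split_choice pick i r c lo hi (tabF st) l) +
       tabF st i (l - split_choice pick i r c lo hi (tabF st) l)"
    "\<forall>l\<in>set ls. tmpG (fold A ls st) i l =
       (tabG st i (l - split_choice pick i r c lo hi (tabF st) l))
         (r := split_choice pick i r c lo hi (tabF st) l)"
    "ops (fold A ls st) \<le> ops st + (\<Sum>l\<in>set ls. 2 * l - 1)"
  using assms(2,3)
proof (induction ls rule: rev_induct)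
  case Nil
  {
    case 1 show ?case by simp
    case 2 show ?case by simp
    case 3 show ?case by simp
    case 4 show ?case by simp
    case 5 show ?case by simp
  }
next
  case (snoc x xs)
  {
    case 1 then show ?case using snoc by (simp add: A_def argmax_step_def Let_def)
    case 2 then show ?case using snoc by (simp add: A_def argmax_step_def Let_def)
    case 3 then show ?case using snoc
      by (auto simp add: A_def argmax_step_def Let_def split_choice_def)
    case 4 then show ?case using snoc
      by (auto simp add: A_def argmax_step_def Let_def split_choice_def)
    case 5 then show ?case using snoc
      by (auto simp add: A_def argmax_step_def Let_def)
  }
qed

lemma fold_copy_step:
  "tabF (fold (copy_step i) ls st) =
     (tabF st)(i := (\<lambda>l. if l \<in> set ls then tmpF st i l else tabF st i l))"
  "tabG (fold (copy_step i) ls st) =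
     (tabG st)(i := (\<lambda>l. if l \<in> set ls then tmpG st i l else tabG st i l))"
  "tmpF (fold (copy_step i) ls st) = tmpF st"
  "tmpG (fold (copy_step i) ls st) = tmpG st"
  "ops (fold (copy_step i) ls st) = ops st"
  by (induction ls rule: rev_induct) (auto simp: copy_step_def fun_eq_iff)

text \<open>
  Common form of \<^const>\<open>inner_child_step\<close> and \<^const>\<open>root_child_step\<close>; \<open>m\<close> is the number of children
  merged before \<open>c\<close>.
\<close>

definition child_step ::
    "choice \<Rightarrow> nat \<Rightarrow> nat \<Rightarrow> nat \<Rightarrow> nat \<Rightarrow> nat \<Rightarrow> nat \<Rightarrow> etp_state \<Rightarrow> etp_state" where
  "child_step pick i r c m L q st =
     (let range = [2..<min L (Suc m * q + 1) + 1]
      in fold (copy_step i) range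
          (fold (\<lambda>l. argmax_step pick i r c (l - (m * q + 1)) (min (l - 1) q) l) range st))"

text \<open>The first \<open>U\<close> odd numbers sum to the square of \<open>U\<close>; the range
  lacks the first of them.\<close>

lemma sum_odd_le: "(\<Sum>l\<in>{2..<U + 1}. 2 * l - 1) \<le> U\<^sup>2" for U :: nat
proof (induction U)
  case (Suc U)
  then show ?case by (cases "U = 0") (auto simp: power2_eq_square)
qed simp

lemma child_step:
  fixes st i r c m L q pick
  defines "st' \<equiv> child_step pick i r c m L q st"
  assumes "valid_choice pick"
  shows "\<forall>x. x \<noteq> i \<longrightarrow> tabF st' x = tabF st x \<and> tabG st' x = tabG st x"
    and "\<forall>l\<le>1. tabF st' i l = tabF st i l \<and> tabG st' i l = tabG st i l"
    and "\<exists>sh. \<forall>l. 2 \<le> l \<and> l \<le> L \<and> l \<le> Suc m * q + 1 \<longrightarrow>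
       is_arg_max (\<lambda>s. tabF st c s + tabF st i (l - s))
         (\<lambda>s. s \<in> {l - (m * q + 1)..min (l - 1) q}) (sh l) \<and>
       tabF st' i l = tabF st c (sh l) + tabF st i (l - sh l) \<and>
       tabG st' i l = (tabG st i (l - sh l))(r := sh l)"
    and "ops st' \<le> ops st + L\<^sup>2"
proof -
  define range where "range = [2..<min L (Suc m * q + 1) + 1]"
  define lo where "lo = (\<lambda>l. l - (m * q + 1))"
  define hi where "hi = (\<lambda>l. min (l - 1) q)"
  define st1 where "st1 = fold (\<lambda>l. argmax_step pick i r c (lo l) (hi l) l) range st"
  have st': "st' = fold (copy_step i) range st1"
    by (simp add: st'_def child_step_def range_def st1_def Let_def lo_def hi_def)
  have "distinct range" "\<forall>l\<in>set range. hi l < l" by (auto simp: range_def hi_def)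
  note A = fold_argmax_step[OF this, where st = st and pick = pick and i = i and r = r and c = c and lo = lo,
      folded st1_def]
  show "\<forall>x. x \<noteq> i \<longrightarrow> tabF st' x = tabF st x \<and> tabG st' x = tabG st x"
    by (simp add: st' fold_copy_step A)
  show "\<forall>l\<le>1. tabF st' i l = tabF st i l \<and> tabG st' i l = tabG st i l"
    by (auto simp add: st' fold_copy_step A range_def)
  show "\<exists>sh. \<forall>l. 2 \<le> l \<and> l \<le> L \<and> l \<le> Suc m * q + 1 \<longrightarrow>
       is_arg_max (\<lambda>s. tabF st c s + tabF st i (l - s))
         (\<lambda>s. s \<in> {l - (m * q + 1)..min (l - 1) q}) (sh l) \<and>
       tabF st' i l = tabF st c (sh l) + tabF st i (l - sh l) \<and>
       tabG st' i l = (tabG st i (l - sh l))(r := sh l)"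
  proof (intro exI[of _ "split_choice pick i r c lo hi (tabF st)"] allI impI)
    fix l assume l: "2 \<le> l \<and> l \<le> L \<and> l \<le> Suc m * q + 1"
    then have "l \<in> set range" by (auto simp: range_def)
    \<comment> \<open>The window is nonempty because \<open>l\<close> is at most
      \<open>Suc m * q + 1\<close>, the size reachable with the new child.\<close>
    moreover have "lo l \<le> hi l" using l by (auto simp: lo_def hi_def)
    note split_choice_is_arg_max[OF assms(2), of lo l hi "tabF st" c i r, OF this]
    ultimately show "is_arg_max (\<lambda>s. tabF st c s + tabF st i (l - s))
         (\<lambda>s. s \<in> {l - (m * q + 1)..min (l - 1) q}) (split_choice pick i r c lo hi (tabF st) l) \<and>
       tabF st' i l = tabF st c (split_choice pick i r c lo hi (tabF st) l) +
         tabF st i (l - split_choice pick i r c lo hi (tabF st) l) \<and>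
       tabG st' i l = (tabG st i (l - split_choice pick i r c lo hi (tabF st) l))
         (r := split_choice pick i r c lo hi (tabF st) l)"
      using A(3,4) by (simp add: st' fold_copy_step lo_def hi_def)
  qed
  have "(\<Sum>l\<in>set range. 2 * l - 1) \<le> (min L (Suc m * q + 1))\<^sup>2"
    using sum_odd_le[of "min L (Suc m * q + 1)"] by (simp only: range_def set_upt)
  also have "\<dots> \<le> L\<^sup>2" by (simp add: power_mono)
  finally show "ops st' \<le> ops st + L\<^sup>2" using A(5) by (simp add: st' fold_copy_step)
qed

text \<open>One form for the root (\<open>a = 2\<close>) and all other inner nodes
  (\<open>a = 1\<close>); \<open>r - a\<close> children have been merged before rank
  \<open>r\<close>.\<close>

definition process_node ::
    "nat \<Rightarrow> (nat \<Rightarrow> real) \<Rightarrow> choice \<Rightarrow> nat \<Rightarrow> nat \<Rightarrow> nat \<Rightarrow> nat \<Rightarrow> nat \<Rightarrow> etp_state \<Rightarrow> etp_state" where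
  "process_node d y pick a b L q i st =
     fold (\<lambda>r. child_step pick i r (d * (i - 1) + r) (r - a) L q) [a..<b] (init_node y i st)"

lemma process_node:
  fixes d y pick a b L q i st
  defines "st' \<equiv> process_node d y pick a b L q i st"
  assumes pick: "valid_choice pick" and "a \<le> b"
    and "\<forall>r\<in>{a..<b}. d * (i - 1) + r \<noteq> i \<and> tabF st (d * (i - 1) + r) 0 = 0"
  shows "node_opt (\<lambda>r. tabF st (d * (i - 1) + r)) ((y i)\<^sup>2) L q {a..<b} (tabF st' i) (tabG st' i) \<and>
    (\<forall>x. x \<noteq> i \<longrightarrow> tabF st' x = tabF st x \<and> tabG st' x = tabG st x) \<and>
    ops st' \<le> ops st + (b - a) * L\<^sup>2"
  using assms(3,4) unfolding st'_def
proof (induction b rule: dec_induct)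
  case base
  then show ?case by (auto simp: process_node_def init_node_def intro!: node_opt_empty)
next
  case (step n)
  define st1 where "st1 = process_node d y pick a n L q i st"
  define c where "c = d * (i - 1) + n"
  have c: "c \<noteq> i" "tabF st c 0 = 0" using step by (auto simp: c_def)
  have st2: "process_node d y pick a (Suc n) L q i st = child_step pick i n c (n - a) L q st1"
    using step by (simp add: process_node_def st1_def c_def)
  have IH: "node_opt (\<lambda>r. tabF st (d * (i - 1) + r)) ((y i)\<^sup>2) L q {a..<n} (tabF st1 i) (tabG st1 i)"
    "\<forall>x. x \<noteq> i \<longrightarrow> tabF st1 x = tabF st x \<and> tabG st1 x = tabG st x"
    "ops st1 \<le> ops st + (n - a) * L\<^sup>2"
    using step by (auto simp: st1_def)
  note cs = child_step[OF pick, where st = st1 and i = i and r = n and c = c and m = "n - a" and L = L and q = q,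
      folded st2]
  obtain sh where sh: "\<forall>l. 2 \<le> l \<and> l \<le> L \<and> l \<le> Suc (n - a) * q + 1 \<longrightarrow>
       is_arg_max (\<lambda>s. tabF st1 c s + tabF st1 i (l - s))
         (\<lambda>s. s \<in> {l - ((n - a) * q + 1)..min (l - 1) q}) (sh l) \<and>
       tabF (process_node d y pick a (Suc n) L q i st) i l = tabF st1 c (sh l) + tabF st1 i (l - sh l) \<and>
       tabG (process_node d y pick a (Suc n) L q i st) i l = (tabG st1 i (l - sh l))(n := sh l)"
    using cs(3) by blast
  have "tabF st1 c = tabF st c" using IH(2) c by simp
  then have "node_opt (\<lambda>r. tabF st (d * (i - 1) + r)) ((y i)\<^sup>2) L q (insert n {a..<n})
     (tabF (process_node d y pick a (Suc n) L q i st) i) (tabG (process_node d y pick a (Suc n) L q i st) i)"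
    using sh c cs(2) by (intro node_opt_insert[OF IH(1), where sh = sh]) (auto simp: c_def)
  moreover have "insert n {a..<n} = {a..<Suc n}" using step by auto
  ultimately show ?case using cs(1,4) IH(2,3) step by (auto simp: Suc_diff_le)
qed


text \<open>No child of a listed node is itself listed, so the rows of the children stay fixed and
  optimality can refer to the state before the loop.\<close>

lemma process_nodes:
  fixes d y pick a b L q "is" st
  defines "st' \<equiv> fold (process_node d y pick a b L q) is st"
  assumes pick: "valid_choice pick" and ab: "a \<le> b" and "distinct is"
    and "\<forall>i\<in>set is. \<forall>r\<in>{a..<b}. d * (i - 1) + r \<notin> set is \<and> tabF st (d * (i - 1) + r) 0 = 0"
  shows "(\<forall>i\<in>set is. node_opt (\<lambda>r. tabF st (d * (i - 1) + r)) ((y i)\<^sup>2) L q {a..<b}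
            (tabF st' i) (tabG st' i)) \<and>
    (\<forall>x. x \<notin> set is \<longrightarrow> tabF st' x = tabF st x \<and> tabG st' x = tabG st x) \<and>
    ops st' \<le> ops st + length is * ((b - a) * L\<^sup>2)"
  using assms(4,5) unfolding st'_def
proof (induction "is" rule: rev_induct)
  case (snoc i xs)
  define st1 where "st1 = fold (process_node d y pick a b L q) xs st"
  have IH: "\<forall>i\<in>set xs. node_opt (\<lambda>r. tabF st (d * (i - 1) + r)) ((y i)\<^sup>2) L q {a..<b}
            (tabF st1 i) (tabG st1 i)"
    "\<forall>x. x \<notin> set xs \<longrightarrow> tabF st1 x = tabF st x \<and> tabG st1 x = tabG st x"
    "ops st1 \<le> ops st + length xs * ((b - a) * L\<^sup>2)"
    using snoc by (auto simp: st1_def)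
  have ch: "d * (i - 1) + r \<noteq> i" "tabF st1 (d * (i - 1) + r) = tabF st (d * (i - 1) + r)"
    "tabF st1 (d * (i - 1) + r) 0 = 0" if "r \<in> {a..<b}" for r
    using snoc.prems(2) that IH(2) by fastforce+
  have eq: "node_opt (\<lambda>r. tabF st1 (d * (i - 1) + r)) v L q {a..<b} f g \<longleftrightarrow>
      node_opt (\<lambda>r. tabF st (d * (i - 1) + r)) v L q {a..<b} f g" for v f g
    unfolding node_opt_def using ch(2) by simp
  note pn = process_node[OF pick ab, of d i st1 y L q, unfolded eq]
  have pn': "node_opt (\<lambda>r. tabF st (d * (i - 1) + r)) ((y i)\<^sup>2) L q {a..<b}
      (tabF (process_node d y pick a b L q i st1) i) (tabG (process_node d y pick a b L q i st1) i)"
    "\<forall>x. x \<noteq> i \<longrightarrow> tabF (process_node d y pick a b L q i st1) x = tabF st1 x \<and>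
        tabG (process_node d y pick a b L q i st1) x = tabG st1 x"
    "ops (process_node d y pick a b L q i st1) \<le> ops st1 + (b - a) * L\<^sup>2"
    using pn ch by blast+
  have "node_opt (\<lambda>r. tabF st (d * (x - 1) + r)) ((y x)\<^sup>2) L q {a..<b}
      (tabF (process_node d y pick a b L q i st1) x) (tabG (process_node d y pick a b L q i st1) x)"
    if "x \<in> set (xs @ [i])" for x
    using that snoc.prems(1) pn'(1,2) IH(1) by (cases "x = i") auto
  then show ?case using pn'(2,3) IH(2,3) by (auto simp: st1_def)
qed simp

text \<open>The rows of the children are taken from the same state, so the property must be shown to
  survive later writes to other nodes.\<close>

definition node_ok :: "nat \<Rightarrow> nat \<Rightarrow> nat \<Rightarrow> (nat \<Rightarrow> real) \<Rightarrow> nat \<Rightarrow> nat \<Rightarrow> etp_state \<Rightarrow> bool" where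
  "node_ok d J k y j i st \<longleftrightarrow>
     node_opt (\<lambda>r. tabF st (d * (i - 1) + r)) ((y i)\<^sup>2) (ell d J k j) (ell d J k (j + 1))
       {max 1 (2 - j)..<d + 1} (tabF st i) (tabG st i)"

text \<open>A leaf has no \<open>G\<close> row, and its entries for \<open>l >= 2\<close> are
  leftover memory. They do no harm, as \<open>ell d J k J\<close> is at most 1.\<close>

definition leaf_ok :: "(nat \<Rightarrow> real) \<Rightarrow> nat \<Rightarrow> etp_state \<Rightarrow> bool" where
  "leaf_ok y i st \<longleftrightarrow> tabF st i 0 = 0 \<and> tabF st i 1 = (y i)\<^sup>2"

lemma node_ok_cong:
  assumes "tabF st' i = tabF st i" "tabG st' i = tabG st i"
    "\<And>r. r \<in> {max 1 (2 - j)..<d + 1} \<Longrightarrow> tabF st' (d * (i - 1) + r) = tabF st (d * (i - 1) + r)"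
  shows "node_ok d J k y j i st' \<longleftrightarrow> node_ok d J k y j i st"
  unfolding node_ok_def node_opt_def using assms by simp

section \<open>Levels, the numbering of children, and the loop over levels\<close>

lemma set_level_nodes:
  "set (level_nodes d j) = (if j = 0 then {1} else {d ^ (j - 1) + 1..d ^ j})"
  by (auto simp: level_nodes_def)

lemma level_less:
  assumes "d \<ge> 2" "i \<in> set (level_nodes d j)" "x \<in> set (level_nodes d j')" "j < j'"
  shows "i < x"
proof -
  have "i \<le> d ^ j" using assms(2) by (auto simp: level_nodes_def split: if_splits)
  also have "d ^ j \<le> d ^ (j' - 1)" using assms by (intro power_increasing) auto
  also have "\<dots> < x" using assms by (auto simp: level_nodes_def)
  finally show ?thesis .
qed

lemma child_in_level:
  assumes "d \<ge> 2" "i \<in> set (level_nodes d j)" "r \<in> {max 1 (2 - j)..<d + 1}"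
  shows "d * (i - 1) + r \<in> set (level_nodes d (Suc j))"
proof (cases "j = 0")
  case True
  then show ?thesis using assms by (auto simp: level_nodes_def)
next
  case False
  then have i: "d ^ (j - 1) \<le> i - 1" "i \<le> d ^ j" "i \<ge> 1" using assms by (auto simp: level_nodes_def)
  have "d ^ j \<le> d * (i - 1)" using i(1) False by (cases j) auto
  moreover have "d * (i - 1) + d \<le> d * d ^ j"
    using i mult_le_mono2[of i "d ^ j" d] by (cases i) auto
  ultimately show ?thesis using assms False by (auto simp: level_nodes_def)
qed

lemma node_ok_value_0: "node_ok d J k y j i st \<Longrightarrow> tabF st i 0 = 0"
  by (simp add: node_ok_def node_opt_def)

definition level_ok :: "nat \<Rightarrow> nat \<Rightarrow> nat \<Rightarrow> (nat \<Rightarrow> real) \<Rightarrow> nat \<Rightarrow> etp_state \<Rightarrow> bool" where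
  "level_ok d J k y j st \<longleftrightarrow>
     (\<forall>i\<in>set (level_nodes d j). if j = J then leaf_ok y i st else node_ok d J k y j i st)"

text \<open>Deeper levels consist of larger node numbers and have their children deeper still, so
  writing the rows of level \<open>j\<close> preserves what is known about them. The case
  \<open>j = 0\<close> later serves the root.\<close>

lemma process_level:
  fixes d J k y pick j st
  defines "st' \<equiv> fold (process_node d y pick (max 1 (2 - j)) (d + 1) (ell d J k j) (ell d J k (j + 1)))
                    (level_nodes d j) st"
  assumes d: "d \<ge> 2" and pick: "valid_choice pick" and j: "j < J"
    and ok: "\<forall>j'\<in>{Suc j..J}. level_ok d J k y j' st"
  shows "\<forall>j'\<in>{j..J}. level_ok d J k y j' st'"
    and "ops st' \<le> ops st +
           length (level_nodes d j) * ((d + 1 - max 1 (2 - j)) * (ell d J k j)\<^sup>2)"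
proof -
  have ch: "d * (i - 1) + r \<notin> set (level_nodes d j)" "tabF st (d * (i - 1) + r) 0 = 0"
    if "i \<in> set (level_nodes d j)" "r \<in> {max 1 (2 - j)..<d + 1}" for i r
  proof -
    note c = child_in_level[OF d that]
    show "d * (i - 1) + r \<notin> set (level_nodes d j)"
      using level_less[OF d _ c, of "d * (i - 1) + r" j] by auto
    have "level_ok d J k y (Suc j) st" using ok j by auto
    then show "tabF st (d * (i - 1) + r) 0 = 0"
      using c by (auto simp: level_ok_def leaf_ok_def node_ok_value_0 split: if_splits)
  qed
  have "distinct (level_nodes d j)" by (simp add: level_nodes_def)
  note pn = process_nodes[OF pick _ this, of "max 1 (2 - j)" "d + 1" d st y "ell d J k j" "ell d J k (j + 1)",
      folded st'_def]
  have pn': "\<forall>i\<in>set (level_nodes d j). node_opt (\<lambda>r. tabF st (d * (i - 1) + r)) ((y i)\<^sup>2)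
       (ell d J k j) (ell d J k (j + 1)) {max 1 (2 - j)..<d + 1} (tabF st' i) (tabG st' i)"
    "\<forall>x. x \<notin> set (level_nodes d j) \<longrightarrow> tabF st' x = tabF st x \<and> tabG st' x = tabG st x"
    "ops st' \<le> ops st +
       length (level_nodes d j) * ((d + 1 - max 1 (2 - j)) * (ell d J k j)\<^sup>2)"
    using pn ch d by auto
  show "ops st' \<le> ops st +
           length (level_nodes d j) * ((d + 1 - max 1 (2 - j)) * (ell d J k j)\<^sup>2)"
    by (fact pn'(3))
  show "\<forall>j'\<in>{j..J}. level_ok d J k y j' st'"
  proof
    fix j' assume j': "j' \<in> {j..J}"
    show "level_ok d J k y j' st'"
    proof (cases "j' = j")
      case True
      have "node_ok d J k y j i st'" if i: "i \<in> set (level_nodes d j)" for i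
      proof -
        have "tabF st' (d * (i - 1) + r) = tabF st (d * (i - 1) + r)"
          if "r \<in> {max 1 (2 - j)..<d + 1}" for r using ch(1)[OF i that] pn'(2) by blast
        then show ?thesis using bspec[OF pn'(1) i] unfolding node_ok_def node_opt_def by simp
      qed
      then show ?thesis using True j by (simp add: level_ok_def)
    next
      case False
      then have jj: "j < j'" using j' by auto
      have same: "tabF st' x = tabF st x \<and> tabG st' x = tabG st x"
        if "x \<in> set (level_nodes d m)" "j < m" for x m
        using pn'(2) level_less[OF d _ that, of x] by blast
      have "level_ok d J k y j' st" using ok j' jj by auto
      moreover have "node_ok d J k y j' i st' \<longleftrightarrow> node_ok d J k y j' i st"
        if "i \<in> set (level_nodes d j')" for i
        using same[OF that jj] same[OF child_in_level[OF d that]] jj by (intro node_ok_cong) auto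
      ultimately show ?thesis using same[OF _ jj] by (auto simp: level_ok_def leaf_ok_def)
    qed
  qed
qed

text \<open>Before rank \<open>r\<close> there are \<open>m = r - 1\<close> merged children, which
  turns the bounds of the algorithm into those of \<open>child_step\<close>.\<close>

lemma process_inner_eq:
  "process_inner d J k y pick =
     fold (\<lambda>j. fold (process_node d y pick (max 1 (2 - j)) (d + 1) (ell d J k j) (ell d J k (j + 1)))
                 (level_nodes d j)) (rev [1..<J])"
proof -
  have "fold (inner_child_step d J k pick j i) [1..<d + 1] st =
      fold (\<lambda>r. child_step pick i r (d * (i - 1) + r) (r - 1) (ell d J k j) (ell d J k (j + 1)))
        [1..<d + 1] st" for j i st
  proof (intro List.fold_cong refl)
    fix r assume "r \<in> set [1..<d + 1]"
    then have "Suc (r - 1) = r" by auto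
    then show "inner_child_step d J k pick j i r =
        child_step pick i r (d * (i - 1) + r) (r - 1) (ell d J k j) (ell d J k (j + 1))"
      by (simp only: inner_child_step_def child_step_def fun_eq_iff Let_def simp_thms)
  qed
  then show ?thesis
    unfolding process_inner_def fun_eq_iff process_node_def
    by (intro allI List.fold_cong refl) auto
qed

lemma process_inner:
  fixes d J k y pick st
  defines "st' \<equiv> process_inner d J k y pick st"
  assumes d: "d \<ge> 2" and J: "J \<ge> 1" and pick: "valid_choice pick" and ok: "level_ok d J k y J st"
  shows "(\<forall>j\<in>{1..J}. level_ok d J k y j st') \<and>
    ops st' \<le> ops st + (\<Sum>j\<in>{1..<J}. length (level_nodes d j) * (d * (ell d J k j)\<^sup>2))"
proof -
  define A where "A = (\<lambda>j. fold (process_node d y pick (max 1 (2 - j)) (d + 1)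
      (ell d J k j) (ell d J k (j + 1))) (level_nodes d j))"
  \<comment> \<open>Downward induction on the level \<open>t\<close> reached so far;
    \<open>rev [t..<J]\<close> treats \<open>t\<close> last.\<close>
  have "1 \<le> t \<Longrightarrow> (\<forall>j\<in>{t..J}. level_ok d J k y j (fold A (rev [t..<J]) st)) \<and>
    ops (fold A (rev [t..<J]) st) \<le>
      ops st + (\<Sum>j\<in>{t..<J}. length (level_nodes d j) * (d * (ell d J k j)\<^sup>2))" if "t \<le> J" for t
    using that
  proof (induction t rule: inc_induct)
    case base
    then show ?case using ok by simp
  next
    case (step n)
    define st1 where "st1 = fold A (rev [Suc n..<J]) st"
    have st2: "fold A (rev [n..<J]) st = A n st1"
      using step by (simp add: upt_conv_Cons st1_def)
    have IH: "\<forall>j\<in>{Suc n..J}. level_ok d J k y j st1"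
      "ops st1 \<le> ops st + (\<Sum>j\<in>{Suc n..<J}. length (level_nodes d j) * (d * (ell d J k j)\<^sup>2))"
      using step by (auto simp: st1_def)
    have pl: "\<forall>j\<in>{n..J}. level_ok d J k y j (A n st1)"
      "ops (A n st1) \<le> ops st1 + length (level_nodes d n) * ((d + 1 - max 1 (2 - n)) * (ell d J k n)\<^sup>2)"
      using process_level[OF d pick _ IH(1)] step by (auto simp: A_def)
    moreover have "max 1 (2 - n) = 1" using step by auto
    ultimately show ?case using step(2) IH(2) unfolding st2
      by (simp add: sum.atLeast_Suc_lessThan)
  qed
  from this[of 1] J show ?thesis by (simp add: st'_def process_inner_eq A_def)
qed

section \<open>The caps as geometric sums\<close>

lemma power_eq_geometric_sum: "d \<ge> 2 \<Longrightarrow> d ^ n = (d - 1) * (\<Sum>i<n. d ^ i) + 1" for d :: nat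
proof (induction n)
  case (Suc n)
  then show ?case by (cases d) (auto simp: algebra_simps)
qed simp

lemma geometric_div: "d \<ge> 2 \<Longrightarrow> (d ^ n - 1) div (d - 1) = (\<Sum>i<n. d ^ i)" for d :: nat
  by (simp add: power_eq_geometric_sum)

text \<open>The division in \<open>ell\<close> is exact. For \<open>1 <= j <= J\<close> the sum
  counts the full subtree below a node of level \<open>j\<close>, level by level.\<close>

lemma ell_eq: "d \<ge> 2 \<Longrightarrow> ell d J k j = min (\<Sum>i<J + 1 - j. d ^ i) (k - j)"
  by (simp only: ell_def geometric_div)

text \<open>
  So the root can be treated as a node of level \<open>0\<close>, although it has only \<open>d - 1\<close> children.
\<close>

lemma ell_0:
  assumes "d \<ge> 2" "k \<le> d ^ J"
  shows "ell d J k 0 = k"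
  using assms by (simp add: ell_eq)

text \<open>At the root the ranks start at 2, so \<open>m = r - 2\<close>, and
  \<open>d * (1 - 1) + r\<close> is just \<open>r\<close>; the cap of level 0 is
  \<open>k\<close>.\<close>

lemma process_root_eq:
  assumes "d \<ge> 2" "k \<le> d ^ J"
  shows "process_root d J k y pick =
    fold (process_node d y pick (max 1 (2 - 0)) (d + 1) (ell d J k 0) (ell d J k (0 + 1))) (level_nodes d 0)"
proof -
  have "fold (root_child_step d J k pick) [2..<d + 1] st =
      fold (\<lambda>r. child_step pick 1 r (d * (1 - 1) + r) (r - 2) k (ell d J k 1)) [2..<d + 1] st" for st
  proof (intro List.fold_cong refl)
    fix r assume "r \<in> set [2..<d + 1]"
    then have "Suc (r - 2) = r - 1" by auto
    then show "root_child_step d J k pick r =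
        child_step pick 1 r (d * (1 - 1) + r) (r - 2) k (ell d J k 1)"
      by (simp add: root_child_step_def child_step_def fun_eq_iff Let_def del: upt_Suc)
  qed
  then show ?thesis
    using ell_0[OF assms]
    by (simp add: process_root_def process_node_def fun_eq_iff level_nodes_def numeral_2_eq_2)
qed

lemma process_leaves:
  "level_ok d J k y J (process_leaves d J y st)" "ops (process_leaves d J y st) = ops st"
proof -
  have "(\<forall>i\<in>set is. leaf_ok y i (fold (init_leaf y) is st)) \<and> ops (fold (init_leaf y) is st) = ops st"
    for "is" by (induction "is" rule: rev_induct) (auto simp: init_leaf_def leaf_ok_def)
  then show "level_ok d J k y J (process_leaves d J y st)" "ops (process_leaves d J y st) = ops st"
    by (auto simp: level_ok_def process_leaves_def)
qed

lemma first_pass: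
  fixes d J k y pick st
  defines "st' \<equiv> first_pass d J k y pick st"
  assumes d: "d \<ge> 2" and J: "J \<ge> 1" and k: "k \<le> d ^ J" and pick: "valid_choice pick"
  shows "\<forall>j\<le>J. level_ok d J k y j st'"
    and "ops st' \<le> ops st + (d - 1) * k\<^sup>2 +
           (\<Sum>j\<in>{1..<J}. length (level_nodes d j) * (d * (ell d J k j)\<^sup>2))"
proof -
  define st1 where "st1 = process_inner d J k y pick (process_leaves d J y st)"
  have st': "st' = process_root d J k y pick st1" by (simp add: st'_def first_pass_def st1_def)
  have st1: "\<forall>j\<in>{1..J}. level_ok d J k y j st1"
    "ops st1 \<le> ops st + (\<Sum>j\<in>{1..<J}. length (level_nodes d j) * (d * (ell d J k j)\<^sup>2))"
    using process_inner[OF d J pick process_leaves(1)] by (auto simp: st1_def process_leaves)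
  have "0 < J" using J by simp
  note pl = process_level[OF d pick this, of k y st1, folded process_root_eq[OF d k] st']
  show "\<forall>j\<le>J. level_ok d J k y j st'" using pl(1) st1(1) by simp
  show "ops st' \<le> ops st + (d - 1) * k\<^sup>2 +
           (\<Sum>j\<in>{1..<J}. length (level_nodes d j) * (d * (ell d J k j)\<^sup>2))"
    using pl(2) st1 ell_0[OF d k] by (simp add: level_nodes_def numeral_2_eq_2)
qed

section \<open>Sums over subtrees\<close>

text \<open>
  Node \<open>i\<close> has the children \<open>d * (i - 1) + r\<close>; for the root, \<open>r = 1\<close> would give the root itself.
\<close>

definition ranks :: "nat \<Rightarrow> nat \<Rightarrow> nat set" where
  "ranks d i = {(if i = 1 then 2 else 1)..<d + 1}"

text \<open>Node 1 occurs in level 0 only, so the admissible ranks can be read off the node. This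
  frees the recursions over the tree from carrying the level.\<close>

lemma ranks_level: "d \<ge> 2 \<Longrightarrow> i \<in> set (level_nodes d j) \<Longrightarrow> {max 1 (2 - j)..<d + 1} = ranks d i"
proof (cases "j = 0")
  case False
  assume "d \<ge> 2" "i \<in> set (level_nodes d j)"
  moreover from this(1) have "1 \<le> d ^ (j - 1)" by simp
  ultimately have "i \<noteq> 1" using False by (auto simp: set_level_nodes simp del: One_nat_def)
  then show ?thesis using False by (auto simp: ranks_def)
qed (simp add: level_nodes_def ranks_def numeral_2_eq_2)

lemma child_in_next_level:
  assumes "d \<ge> 2" "i \<in> set (level_nodes d j)" "r \<in> ranks d i"
  shows "d * (i - 1) + r \<in> set (level_nodes d (Suc j))"
  using child_in_level[OF assms(1,2)] assms(3) ranks_level[OF assms(1,2)] by blast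

text \<open>Dividing \<open>c - 1\<close> by \<open>d\<close> leaves quotient \<open>i - 1\<close>
  and remainder \<open>r - 1\<close>. The formula also covers the root, whose children
  \<open>2..d\<close> have quotient 0.\<close>

lemma parent_of_child: "r \<in> ranks d i \<Longrightarrow> i \<ge> 1 \<Longrightarrow> (d * (i - 1) + r - 1) div d + 1 = i"
proof -
  assume r: "r \<in> ranks d i" and i: "i \<ge> 1"
  then have "d * (i - 1) + r - 1 = (r - 1) + (i - 1) * d" "r - 1 < d" "d \<noteq> 0"
    by (auto simp: ranks_def mult.commute split: if_splits)
  then show ?thesis using i by simp
qed

lemma less_child: "d \<ge> 2 \<Longrightarrow> r \<in> ranks d i \<Longrightarrow> i \<ge> 1 \<Longrightarrow> i < d * (i - 1) + r"
proof -
  assume d: "d \<ge> 2" and r: "r \<in> ranks d i" and i: "i \<ge> 1"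
  have "2 * (i - 1) \<le> d * (i - 1)" using d by (intro mult_le_mono1)
  moreover have "1 \<le> r" "i = 1 \<longrightarrow> 2 \<le> r" using r by (auto simp: ranks_def split: if_splits)
  ultimately show ?thesis using i by linarith
qed

lemma parent_less: "d \<ge> 2 \<Longrightarrow> c \<ge> 2 \<Longrightarrow> (c - 1) div d + 1 < c" for d :: nat
  using div_less_dividend[of d "c - 1"] by linarith

lemma level_pos: "i \<in> set (level_nodes d j) \<Longrightarrow> i \<ge> 1"
  by (auto simp: level_nodes_def split: if_splits)

lemma level_parent:
  assumes d: "d \<ge> 2" and i: "i \<in> set (level_nodes d (Suc j))"
  shows "\<exists>p\<in>set (level_nodes d j). \<exists>r\<in>ranks d p. i = d * (p - 1) + r"
proof -
  have "d ^ j + 1 \<le> i" "i \<le> d * d ^ j" using i by (simp_all add: set_level_nodes)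
  then have i': "d ^ j \<le> i - 1" "i - 1 < d * d ^ j" "i \<ge> 1" by linarith+
  define p where "p = (i - 1) div d + 1"
  define r where "r = (i - 1) mod d + 1"
  have e: "i = d * (p - 1) + r" using i' by (simp add: p_def r_def)
  have rd: "1 \<le> r" "r \<le> d" using d by (auto simp: r_def Suc_le_eq)
  have up: "p \<le> d ^ j" using i' less_mult_imp_div_less[of "i - 1" "d ^ j" d]
    by (simp add: p_def mult.commute)
  show ?thesis
  proof (cases "j = 0")
    case True
    then have "p = 1" using up by (simp add: p_def)
    moreover have "2 \<le> r" using e \<open>p = 1\<close> i' True by simp
    ultimately show ?thesis using True e rd by (auto simp: level_nodes_def ranks_def)
  next
    case False
    then have "d * d ^ (j - 1) \<le> i - 1" using i' by (cases j) auto
    then have "d ^ (j - 1) \<le> (i - 1) div d" using d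
      by (metis div_le_mono nonzero_mult_div_cancel_left not_numeral_le_zero)
    moreover have "1 \<le> d ^ (j - 1)" using d by simp
    ultimately have "d ^ (j - 1) + 1 \<le> p" "p \<noteq> 1" by (auto simp: p_def)
    then have "p \<in> set (level_nodes d j)" "r \<in> ranks d p"
      using False up rd by (auto simp: set_level_nodes ranks_def)
    then show ?thesis using e by blast
  qed
qed

lemma level_inner_le: "d \<ge> 2 \<Longrightarrow> i \<in> set (level_nodes d j) \<Longrightarrow> j < J \<Longrightarrow> i \<le> d ^ (J - 1)"
proof -
  assume d: "d \<ge> 2" and i: "i \<in> set (level_nodes d j)" and j: "j < J"
  have "i \<le> d ^ j" using i by (auto simp: level_nodes_def split: if_splits)
  also have "d ^ j \<le> d ^ (J - 1)" using d j by (intro power_increasing) auto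
  finally show ?thesis .
qed

text \<open>Structural induction on the tree from the leaves upwards. The predicate carries the
  level because the caps depend on it.\<close>

lemma level_induct:
  assumes "j \<le> J" "i \<in> set (level_nodes d j)" "d \<ge> 2"
    and leaf: "\<And>i. i \<in> set (level_nodes d J) \<Longrightarrow> P J i"
    and inner: "\<And>j i. j < J \<Longrightarrow> i \<in> set (level_nodes d j) \<Longrightarrow>
        (\<And>r. r \<in> ranks d i \<Longrightarrow> P (Suc j) (d * (i - 1) + r)) \<Longrightarrow> P j i"
  shows "P j i"
  using assms(1,2)
proof (induction j arbitrary: i rule: inc_induct)
  case base
  then show ?case using leaf by simp
next
  case (step n)
  show ?case
  proof (rule inner[OF step.hyps(2) step.prems])
    fix r assume "r \<in> ranks d i"
    then show "P (Suc n) (d * (i - 1) + r)"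
      by (intro step.IH child_in_next_level[OF \<open>d \<ge> 2\<close> step.prems])
  qed
qed

text \<open>\<open>M\<close> stands for the last node with children, \<open>d ^ (J - 1)\<close>. The
  recursion terminates because children have larger numbers than their parent. The value type is
  polymorphic to cover both node counts and energies.\<close>

function subtree_sum :: "nat \<Rightarrow> nat \<Rightarrow> (nat \<Rightarrow> 'a::comm_monoid_add) \<Rightarrow> nat \<Rightarrow> 'a" where
  "subtree_sum d M f i =
     (if i = 0 \<or> M < i \<or> d < 2 then f i
      else f i + (\<Sum>r\<in>ranks d i. subtree_sum d M f (d * (i - 1) + r)))"
  by pat_completeness auto
termination
proof (relation "Wellfounded.measure (\<lambda>(d, M, f, i). Suc M - i)")
  fix d M :: nat and f :: "nat \<Rightarrow> 'a" and i r
  assume "\<not> (i = 0 \<or> M < i \<or> d < 2)" "r \<in> ranks d i"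
  then show "((d, M, f, d * (i - 1) + r), d, M, f, i) \<in> Wellfounded.measure (\<lambda>(d, M, f, i). Suc M - i)"
    using less_child[of d r i] by auto
qed simp

declare subtree_sum.simps [simp del]

text \<open>
  The nodes \<open>1, \<dots>, n\<close> have precisely the children \<open>2, \<dots>, d * n\<close>, so those of them
  outside \<open>{1..n}\<close> carry the remaining sum.
\<close>

lemma subtree_sum_root:
  assumes d: "d \<ge> 2" and n: "1 \<le> n" "n \<le> M"
  shows "(\<Sum>i\<in>{1..n}. f i) + (\<Sum>c\<in>{n + 1..d * n}. subtree_sum d M f c) = subtree_sum d M f 1"
  using n
proof (induction n rule: dec_induct)
  case base
  have "ranks d 1 = {Suc 1..d}" by (auto simp: ranks_def)
  then show ?case using d base subtree_sum.simps[of d M f 1] by simp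
next
  case (step n)
  have "2 * n \<le> d * n" using d by (intro mult_le_mono1)
  then have dn: "Suc n \<le> d * n" using step(1) by linarith
  have r: "ranks d (Suc n) = {1..d}" using step by (auto simp: ranks_def)
  have "(\<Sum>c\<in>{n + 1..d * n}. subtree_sum d M f c) =
      subtree_sum d M f (Suc n) + (\<Sum>c\<in>{n + 2..d * n}. subtree_sum d M f c)"
    using dn by (simp add: sum.atLeast_Suc_atMost)
  also have "subtree_sum d M f (Suc n) = f (Suc n) + (\<Sum>r\<in>{1..d}. subtree_sum d M f (r + d * n))"
    using d step r subtree_sum.simps[of d M f "Suc n"] by (simp add: add.commute)
  also have "(\<Sum>r\<in>{1..d}. subtree_sum d M f (r + d * n)) = (\<Sum>c\<in>{d * n + 1..d * n + d}. subtree_sum d M f c)"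
    using sum.shift_bounds_cl_nat_ivl[of "subtree_sum d M f" 1 "d * n" d] by (simp add: add.commute)
  finally have "(\<Sum>c\<in>{n + 1..d * n}. subtree_sum d M f c) = f (Suc n) +
      ((\<Sum>c\<in>{n + 2..d * n}. subtree_sum d M f c) + (\<Sum>c\<in>{d * n + 1..d * n + d}. subtree_sum d M f c))"
    by (simp add: ac_simps)
  also have "(\<Sum>c\<in>{n + 2..d * n}. subtree_sum d M f c) + (\<Sum>c\<in>{d * n + 1..d * n + d}. subtree_sum d M f c) =
      (\<Sum>c\<in>{n + 2..d * n + d}. subtree_sum d M f c)"
    using dn by (intro sum.ub_add_nat[symmetric]) auto
  finally show ?case using step by (simp add: ac_simps)
qed

text \<open>The case \<open>n = M\<close> of \<open>subtree_sum_root\<close>: the nodes in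
  \<open>{M + 1..d * M}\<close> are then the leaves, where a subtree sum is the value
  itself.\<close>

lemma sum_nodes_eq_subtree_sum:
  assumes "d \<ge> 2" "J \<ge> 1"
  shows "(\<Sum>i\<in>{1..d ^ J}. f i) = subtree_sum d (d ^ (J - 1)) f 1"
proof -
  have J: "d ^ J = d * d ^ (J - 1)" using assms by (cases J) auto
  have le: "1 \<le> d ^ (J - 1)" "d ^ (J - 1) \<le> d * d ^ (J - 1)" using assms by auto
  have "(\<Sum>c\<in>{d ^ (J - 1) + 1..d * d ^ (J - 1)}. subtree_sum d (d ^ (J - 1)) f c) =
      (\<Sum>c\<in>{d ^ (J - 1) + 1..d * d ^ (J - 1)}. f c)"
    by (intro sum.cong refl) (simp add: subtree_sum.simps)
  then have "subtree_sum d (d ^ (J - 1)) f 1 =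
      (\<Sum>i\<in>{1..d ^ (J - 1)}. f i) + (\<Sum>c\<in>{d ^ (J - 1) + 1..d * d ^ (J - 1)}. f c)"
    using subtree_sum_root[OF assms(1) le(1) order_refl, of f] by simp
  also have "\<dots> = (\<Sum>i\<in>{1..d * d ^ (J - 1)}. f i)"
    using sum.ub_add_nat[of 1 "d ^ (J - 1)" f "d * d ^ (J - 1) - d ^ (J - 1)"] le by simp
  finally show ?thesis by (simp add: J)
qed

lemma subtree_sum_root_mem:
  assumes "d \<ge> 2" "J \<ge> 1" "A \<subseteq> {1..d ^ J}"
  shows "subtree_sum d (d ^ (J - 1)) (\<lambda>x. if x \<in> A then f x else 0) 1 = sum f A"
proof -
  have "sum f A = (\<Sum>x\<in>{1..d ^ J}. if x \<in> A then f x else 0)"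
    using assms(3) sum.inter_restrict[of "{1..d ^ J}" f A] by (simp add: Int_absorb1)
  then show ?thesis using sum_nodes_eq_subtree_sum[OF assms(1,2)] by metis
qed

lemma subtree_sum_leaf:
  assumes "J \<ge> 1" "i \<in> set (level_nodes d J)"
  shows "subtree_sum d (d ^ (J - 1)) f i = f i"
proof -
  have "d ^ (J - 1) < i" using assms by (simp add: set_level_nodes)
  then show ?thesis by (subst subtree_sum.simps) simp
qed

lemma subtree_sum_inner:
  assumes "d \<ge> 2" "j < J" "i \<in> set (level_nodes d j)"
  shows "subtree_sum d (d ^ (J - 1)) f i =
     f i + (\<Sum>r\<in>ranks d i. subtree_sum d (d ^ (J - 1)) f (d * (i - 1) + r))"
  using level_inner_le[OF assms(1,3,2)] level_pos[OF assms(3)] assms(1)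
  by (subst subtree_sum.simps) auto

section \<open>Optimality\<close>

text \<open>A parent-closed set that misses \<open>i\<close> misses all descendants of
  \<open>i\<close>.\<close>

lemma subtree_sum_eq_0:
  assumes "d \<ge> 2" "J \<ge> 1" "j \<le> J" "i \<in> set (level_nodes d j)"
    and A: "\<forall>p r. p \<ge> 1 \<and> r \<in> ranks d p \<and> d * (p - 1) + r \<in> A \<longrightarrow> p \<in> A"
    and "i \<notin> A"
  shows "subtree_sum d (d ^ (J - 1)) (\<lambda>x. if x \<in> A then g x else 0) i = 0"
  using assms(6)
proof (induction rule: level_induct[OF assms(3,4,1)])
  case (1 i)
  then show ?case by (simp only: subtree_sum_leaf[OF assms(2)]) simp
next
  case (2 j i)
  have "d * (i - 1) + r \<notin> A" if "r \<in> ranks d i" for r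
    using A that 2(4) level_pos[OF 2(2)] by blast
  then show ?case unfolding subtree_sum_inner[OF assms(1) 2(1,2)] using 2 by simp
qed

text \<open>One node plus at most \<open>d\<close> smaller subtrees shifts the geometric sum by one
  term. This is generous at the root, where the cap is \<open>k\<close> anyway.\<close>

lemma subtree_card_le:
  assumes "d \<ge> 2" "J \<ge> 1" "j \<le> J" "i \<in> set (level_nodes d j)"
  shows "subtree_sum d (d ^ (J - 1)) (\<lambda>x. if x \<in> A then 1 else 0) i \<le> (\<Sum>t<J + 1 - j. d ^ t)"
proof (induction rule: level_induct[OF assms(3,4,1)])
  case (1 i)
  then show ?case by (simp only: subtree_sum_leaf[OF assms(2)]) simp
next
  case (2 j i)
  let ?W = "subtree_sum d (d ^ (J - 1)) (\<lambda>x. if x \<in> A then 1 else 0 :: nat)"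
  have "?W i \<le> 1 + (\<Sum>r\<in>ranks d i. ?W (d * (i - 1) + r))"
    unfolding subtree_sum_inner[OF assms(1) 2(1,2)] by simp
  also have "\<dots> \<le> 1 + card (ranks d i) * (\<Sum>t<J - j. d ^ t)"
    using sum_bounded_above[of "ranks d i" "\<lambda>r. ?W (d * (i - 1) + r)" "\<Sum>t<J - j. d ^ t"] 2(3) by simp
  also have "\<dots> \<le> 1 + d * (\<Sum>t<J - j. d ^ t)" by (auto simp: ranks_def)
  also have "\<dots> = (\<Sum>t<Suc (J - j). d ^ t)"
    by (simp add: sum.lessThan_Suc_shift sum_distrib_left del: sum.lessThan_Suc)
  finally show ?case using 2(1) by (simp add: Suc_diff_le)
qed

lemma children_rank:
  assumes "d \<ge> 2" "c \<in> children d J p"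
  shows "(c - 1) div d + 1 = p"
proof (cases "p = 1")
  case True
  then show ?thesis using assms by (auto simp: children_def)
next
  case False
  then have "2 \<le> p" "d * (p - 1) + 1 \<le> c" "c \<le> d * p"
    using assms by (auto simp: children_def split: if_splits)
  moreover have "d * p = d * (p - 1) + d" using \<open>2 \<le> p\<close> by (cases p) auto
  moreover define x where "x = c - 1 - d * (p - 1)"
  ultimately have "c - 1 = x + (p - 1) * d" "x < d"
    using assms(1) by (auto simp: mult.commute)
  then have "(c - 1) div d = p - 1" by simp
  then show ?thesis using \<open>2 \<le> p\<close> by simp
qed

text \<open>From the leaves upwards, \<open>w i\<close> is at most the entry of row \<open>i\<close>
  at \<open>n i\<close>, by the upper bound half of \<open>node_opt\<close> applied to the sizes
  \<open>n\<close> of the children. At the root \<open>n 1 = k\<close>.\<close>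

lemma rooted_tree_weight_le:
  assumes d: "d \<ge> 2" and J: "J \<ge> 1" and k: "k \<le> d ^ J"
    and ok: "\<forall>j\<le>J. level_ok d J k y j st" and A: "A \<in> rooted_trees d J k"
  shows "(\<Sum>x\<in>A. (y x)\<^sup>2) \<le> tabF st 1 k"
proof -
  define n where "n = subtree_sum d (d ^ (J - 1)) (\<lambda>x. if x \<in> A then 1 else 0 :: nat)"
  define w where "w = subtree_sum d (d ^ (J - 1)) (\<lambda>x. if x \<in> A then (y x)\<^sup>2 else 0)"
  have AN: "A \<subseteq> {1..d ^ J}" "card A = k" "1 \<in> A" using A by (auto simp: rooted_trees_def)
  then have fin: "finite A" using finite_subset by blast
  have cl: "\<forall>p r. p \<ge> 1 \<and> r \<in> ranks d p \<and> d * (p - 1) + r \<in> A \<longrightarrow> p \<in> A"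
  proof (intro allI impI, elim conjE)
    fix p r assume p: "p \<ge> 1" and r: "r \<in> ranks d p" and c: "d * (p - 1) + r \<in> A"
    then have "d * (p - 1) + r \<noteq> 1" using less_child[OF d r p] by simp
    then obtain q where "q \<in> A" "d * (p - 1) + r \<in> children d J q"
      using A c by (auto simp: rooted_trees_def)
    then show "p \<in> A" using children_rank[OF d] parent_of_child[OF r p] by metis
  qed
  have n1: "n 1 = k" unfolding n_def subtree_sum_root_mem[OF d J AN(1)] using AN(2) by simp
  have w1: "w 1 = (\<Sum>x\<in>A. (y x)\<^sup>2)" unfolding w_def by (rule subtree_sum_root_mem[OF d J AN(1)])
  have n0: "n i = 0" "w i = 0" if "i \<notin> A" "j \<le> J" "i \<in> set (level_nodes d j)" for i j
    using subtree_sum_eq_0[OF d J that(2,3) cl that(1)] by (auto simp: n_def w_def)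
  have inner: "n i = 1 + (\<Sum>r\<in>ranks d i. n (d * (i - 1) + r))"
    "w i = (y i)\<^sup>2 + (\<Sum>r\<in>ranks d i. w (d * (i - 1) + r))"
    if "i \<in> A" "j < J" "i \<in> set (level_nodes d j)" for i j
    using that(1) unfolding n_def w_def subtree_sum_inner[OF d that(2,3)] by auto
  \<comment> \<open>Going down from a selected parent to a selected child loses at least the parent
    itself.\<close>
  have depth: "n i + j \<le> k" if "j \<le> J" "i \<in> set (level_nodes d j)" "i \<in> A" for i j
    using that
  proof (induction j arbitrary: i)
    case 0
    then show ?case using n1 by (simp add: level_nodes_def)
  next
    case (Suc j)
    obtain p r where p: "p \<in> set (level_nodes d j)" "r \<in> ranks d p" "i = d * (p - 1) + r"
      using level_parent[OF d Suc.prems(2)] by blast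
    have pA: "p \<in> A" using cl p Suc.prems(3) level_pos[OF p(1)] by blast
    have "n i \<le> (\<Sum>r\<in>ranks d p. n (d * (p - 1) + r))"
      using p member_le_sum[of r "ranks d p" "\<lambda>r. n (d * (p - 1) + r)"] by (simp add: ranks_def)
    then show ?case using inner(1)[OF pA _ p(1)] Suc.IH[OF _ p(1) pA] Suc.prems(1) by simp
  qed
  have nl: "n i \<le> ell d J k j" if "j \<le> J" "i \<in> set (level_nodes d j)" for i j
    using n0(1)[OF _ that] depth[OF that] subtree_card_le[OF d J that, of A]
    by (cases "i \<in> A") (auto simp: ell_eq[OF d] n_def)
  have "w i \<le> tabF st i (n i)" if "j \<le> J" "i \<in> set (level_nodes d j)" for i j
  proof (induction rule: level_induct[OF that d])
    case (1 i)
    have "leaf_ok y i st" using ok 1 by (auto simp: level_ok_def)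
    then show ?case
      unfolding n_def w_def subtree_sum_leaf[OF J 1] by (simp add: leaf_ok_def)
  next
    case (2 j i)
    have nd: "node_ok d J k y j i st" using ok 2(1,2) by (auto simp: level_ok_def)
    show ?case
    proof (cases "i \<in> A")
      case True
      have "n i = 1 + (\<Sum>r\<in>ranks d i. n (d * (i - 1) + r))" "n i \<le> ell d J k j"
        using inner(1)[OF True 2(1,2)] nl[of j i] 2(1,2) by auto
      moreover have "\<forall>r\<in>ranks d i. n (d * (i - 1) + r) \<le> ell d J k (j + 1)"
        using nl[of "Suc j", OF _ child_in_next_level[OF d 2(2)]] 2(1) by simp
      ultimately have "(y i)\<^sup>2 + (\<Sum>r\<in>ranks d i. tabF st (d * (i - 1) + r) (n (d * (i - 1) + r))) \<le> tabF st i (n i)"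
        using nd unfolding node_ok_def node_opt_def ranks_level[OF d 2(2)] by auto
      moreover have "(\<Sum>r\<in>ranks d i. w (d * (i - 1) + r)) \<le>
          (\<Sum>r\<in>ranks d i. tabF st (d * (i - 1) + r) (n (d * (i - 1) + r)))"
        using 2(3) by (intro sum_mono)
      ultimately show ?thesis using inner(2)[OF True 2(1,2)] by simp
    next
      case False
      then show ?thesis using n0[OF False _ 2(2)] 2(1) node_ok_value_0[OF nd] by simp
    qed
  qed
  from this[of 0 1] show ?thesis unfolding n1 w1 by (simp add: level_nodes_def)
qed

text \<open>Merging all children reaches every size up to the cap of the node, so the attainment
  half of \<open>node_opt\<close> covers the whole range \<open>1..l(j)\<close>.\<close>

lemma ell_le:
  assumes d: "d \<ge> 2" and j: "j < J" and k: "k \<le> d ^ J" and i: "i \<in> set (level_nodes d j)"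
  shows "ell d J k j \<le> card (ranks d i) * ell d J k (j + 1) + 1"
proof -
  define S where "S = (\<Sum>t<J - j. d ^ t)"
  have S: "(\<Sum>t<J + 1 - j. d ^ t) = d * S + 1"
    using j unfolding S_def
    by (simp add: Suc_diff_le sum.lessThan_Suc_shift sum_distrib_left del: sum.lessThan_Suc)
  have e1: "ell d J k (j + 1) = min S (k - j - 1)" by (simp add: ell_eq[OF d] S_def)
  show ?thesis
  proof (cases "j = 0")
    case True
    have "card (ranks d i) = d - 1" using True i by (simp add: ranks_def level_nodes_def)
    \<comment> \<open>The root has one child fewer than the general pattern, so here
      \<open>S\<close> must suffice with factor \<open>d - 1\<close>; it does because
      \<open>N = (d - 1) * S + 1\<close>.\<close>
    moreover have "k \<le> (d - 1) * S + 1"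
    proof -
      show ?thesis using k power_eq_geometric_sum[of d J] d True by (simp add: S_def)
    qed
    moreover have "k - 1 \<le> (d - 1) * (k - 1)"
    proof -
      have "1 \<le> d - 1" using d by linarith
      from mult_le_mono1[OF this, of "k - 1"] show ?thesis by (simp only: mult_1)
    qed
    then have "k \<le> (d - 1) * (k - 1) + 1" by linarith
    ultimately show ?thesis using ell_0[OF d k] True unfolding e1 by (auto simp: min_def)
  next
    case False
    have "card (ranks d i) = d"
      using False by (simp add: ranks_level[OF d i, symmetric])
    moreover have "k - j - 1 \<le> d * (k - j - 1)" using d by simp
    then have "k - j \<le> d * (k - j - 1) + 1" by linarith
    moreover have "min (d * S + 1) (k - j) \<le> d * min S (k - j - 1) + 1" if "k - j \<le> d * (k - j - 1) + 1"
      using that by (cases "S \<le> k - j - 1") (simp_all add: min.coboundedI1 min.coboundedI2)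
    ultimately show ?thesis unfolding e1 ell_eq[OF d, of J k j] S by simp
  qed
qed

text \<open>
  The value that the second pass assigns to \<open>\<Gamma>\<^sub>c\<close>, or \<open>0\<close> if it leaves \<open>\<tau>\<^sub>c = 0\<close>.
\<close>

function subtree_size :: "nat \<Rightarrow> nat \<Rightarrow> (nat \<Rightarrow> nat \<Rightarrow> nat \<Rightarrow> nat) \<Rightarrow> nat \<Rightarrow> nat" where
  "subtree_size d k g c =
     (if c \<le> 1 \<or> d < 2 then k
      else if subtree_size d k g ((c - 1) div d + 1) = 0 then 0
      else g ((c - 1) div d + 1) (subtree_size d k g ((c - 1) div d + 1)) (c - d * ((c - 1) div d)))"
  by pat_completeness auto
termination
  using parent_less by (relation "Wellfounded.measure (\<lambda>(d, k, g, c). c)") (auto simp: not_le not_less)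

declare subtree_size.simps [simp del]

lemma subtree_size_root: "subtree_size d k g 1 = k"
  by (simp add: subtree_size.simps)

lemma subtree_size_child:
  assumes "d \<ge> 2" "i \<ge> 1" "r \<in> ranks d i"
  shows "subtree_size d k g (d * (i - 1) + r) =
    (if subtree_size d k g i = 0 then 0 else g i (subtree_size d k g i) r)"
proof -
  note p = parent_of_child[OF assms(3,2)]
  then have q: "(d * (i - 1) + r - 1) div d = i - 1" by simp
  have "\<not> (d * (i - 1) + r \<le> 1 \<or> d < 2)" using less_child[OF assms(1,3,2)] assms by linarith
  then show ?thesis
    by (subst subtree_size.simps) (simp only: p if_False, simp only: q diff_add_inverse)
qed

text \<open>The sizes are only promises made at the parents. Going down, they respect the caps, so
  every entry of \<open>G\<close> consulted is an optimal distribution; going up, the number of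
  selected nodes below \<open>i\<close> turns out to be the promised size.\<close>

lemma backtracked_tree:
  fixes d J k y st
  defines "A \<equiv> {c \<in> {1..d ^ J}. 0 < subtree_size d k (tabG st) c}"
  assumes d: "d \<ge> 2" and J: "J \<ge> 1" and k: "1 \<le> k" "k \<le> d ^ J"
    and ok: "\<forall>j\<le>J. level_ok d J k y j st"
  shows "A \<in> rooted_trees d J k" and "(\<Sum>x\<in>A. (y x)\<^sup>2) = tabF st 1 k"
proof -
  define sz where "sz = subtree_size d k (tabG st)"
  define n where "n = subtree_sum d (d ^ (J - 1)) (\<lambda>x. if x \<in> A then 1 else 0 :: nat)"
  define w where "w = subtree_sum d (d ^ (J - 1)) (\<lambda>x. if x \<in> A then (y x)\<^sup>2 else 0)"
  have att: "(\<forall>r\<in>ranks d i. tabG st i (sz i) r \<le> ell d J k (Suc j)) \<and>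
      1 + (\<Sum>r\<in>ranks d i. tabG st i (sz i) r) = sz i \<and>
      tabF st i (sz i) = (y i)\<^sup>2 + (\<Sum>r\<in>ranks d i. tabF st (d * (i - 1) + r) (tabG st i (sz i) r))"
    if "j < J" "i \<in> set (level_nodes d j)" "0 < sz i" "sz i \<le> ell d J k j" for i j
  proof -
    have "node_ok d J k y j i st" using ok that by (auto simp: level_ok_def)
    moreover have "1 \<le> sz i" "sz i \<le> max 1 (ell d J k j)"
        "sz i \<le> card (ranks d i) * ell d J k (j + 1) + 1"
      using that ell_le[OF d that(1) k(2) that(2)] by linarith+
    ultimately show ?thesis
      unfolding node_ok_def node_opt_def ranks_level[OF d that(2)] by simp
  qed
  have le: "sz i \<le> ell d J k j" if "j \<le> J" "i \<in> set (level_nodes d j)" for i j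
    using that
  proof (induction j arbitrary: i)
    case 0
    then show ?case by (simp add: level_nodes_def sz_def subtree_size_root[simplified] ell_0[OF d k(2)])
  next
    case (Suc j)
    obtain p r where p: "p \<in> set (level_nodes d j)" "r \<in> ranks d p" "i = d * (p - 1) + r"
      using level_parent[OF d Suc.prems(2)] by blast
    have "sz i = (if sz p = 0 then 0 else tabG st p (sz p) r)"
      unfolding p(3) sz_def by (rule subtree_size_child[OF d level_pos[OF p(1)] p(2)])
    then show ?case using att[OF _ p(1)] Suc p by auto
  qed
  have lvN: "i \<in> {1..d ^ J}" if "j \<le> J" "i \<in> set (level_nodes d j)" for i j
  proof -
    have "i \<le> d ^ j" using that by (auto simp: level_nodes_def split: if_splits)
    also have "d ^ j \<le> d ^ J" using d that by (intro power_increasing) auto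
    finally show ?thesis using level_pos[OF that(2)] by simp
  qed
  have memA: "i \<in> A \<longleftrightarrow> 0 < sz i" if "j \<le> J" "i \<in> set (level_nodes d j)" for i j
    using lvN[OF that] by (simp add: A_def sz_def)
  have "n i = sz i \<and> w i = tabF st i (sz i)" if "j \<le> J" "i \<in> set (level_nodes d j)" for i j
  proof (induction rule: level_induct[OF that d])
    case (1 i)
    \<comment> \<open>A leaf can be promised at most one node, which is where the count
      starts.\<close>
    have "ell d J k J \<le> 1" by (simp add: ell_eq[OF d])
    then have "sz i = 0 \<or> sz i = 1" using le[OF order_refl 1] by linarith
    moreover have "leaf_ok y i st" using ok 1 by (auto simp: level_ok_def)
    ultimately show ?case using memA[OF order_refl 1]
      unfolding n_def w_def subtree_sum_leaf[OF J 1] by (auto simp: leaf_ok_def)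
  next
    case (2 j i)
    have nd: "node_ok d J k y j i st" using ok 2(1,2) by (auto simp: level_ok_def)
    have F0: "tabF st (d * (i - 1) + r) 0 = 0" if "r \<in> ranks d i" for r
    proof -
      have "level_ok d J k y (Suc j) st" using ok 2(1) by auto
      then show ?thesis using child_in_next_level[OF d 2(2) that]
        by (auto simp: level_ok_def leaf_ok_def node_ok_value_0 split: if_splits)
    qed
    have ch: "sz (d * (i - 1) + r) = (if sz i = 0 then 0 else tabG st i (sz i) r)" if "r \<in> ranks d i" for r
      unfolding sz_def by (rule subtree_size_child[OF d level_pos[OF 2(2)] that])
    have ni: "n i = (if i \<in> A then 1 else 0) + (\<Sum>r\<in>ranks d i. n (d * (i - 1) + r))"
      "w i = (if i \<in> A then (y i)\<^sup>2 else 0) + (\<Sum>r\<in>ranks d i. w (d * (i - 1) + r))"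
      unfolding n_def w_def by (rule subtree_sum_inner[OF d 2(1,2)])+
    have iA: "i \<in> A \<longleftrightarrow> 0 < sz i" using memA[of j] 2(1,2) by simp
    show ?case
    proof (cases "sz i = 0")
      case True
      then show ?thesis using ni 2(3) ch iA F0 node_ok_value_0[OF nd] by simp
    next
      case False
      then have "(\<Sum>r\<in>ranks d i. n (d * (i - 1) + r)) = (\<Sum>r\<in>ranks d i. tabG st i (sz i) r)"
        "(\<Sum>r\<in>ranks d i. w (d * (i - 1) + r)) =
          (\<Sum>r\<in>ranks d i. tabF st (d * (i - 1) + r) (tabG st i (sz i) r))"
        using 2(3) ch by simp_all
      then show ?thesis using False ni iA att[OF 2(1,2)] le[of j i] 2(1,2) by simp
    qed
  qed
  from this[of 0 1] have nw: "n 1 = k" "w 1 = tabF st 1 k"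
    by (simp_all add: level_nodes_def sz_def subtree_size_root[simplified])
  have AN: "A \<subseteq> {1..d ^ J}" by (auto simp: A_def)
  show "(\<Sum>x\<in>A. (y x)\<^sup>2) = tabF st 1 k"
    using nw(2) unfolding w_def subtree_sum_root_mem[OF d J AN] .
  have "card A = k"
    using nw(1) unfolding n_def subtree_sum_root_mem[OF d J AN] by simp
  moreover have "1 \<in> A" using k by (simp add: A_def subtree_size_root[simplified])
  moreover have "\<exists>p\<in>A. c \<in> children d J p" if c: "c \<in> A" "c \<noteq> 1" for c
  proof -
    define p where "p = (c - 1) div d + 1"
    have c2: "2 \<le> c" "c \<le> d ^ J" "0 < subtree_size d k (tabG st) c" using c by (auto simp: A_def)
    \<comment> \<open>A node below a parent of size 0 gets size 0 by definition, so positivity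
      passes to the parent.\<close>
    then have "0 < subtree_size d k (tabG st) p"
      using d subtree_size.simps[of d k "tabG st" c] by (auto simp: p_def split: if_splits)
    moreover have "p \<le> d ^ J" using parent_less[OF d c2(1)] c2 by (simp add: p_def)
    ultimately have "p \<in> A" by (simp add: A_def p_def)
    moreover have "p \<le> d ^ (J - 1)"
    proof -
      have "d ^ J = d ^ (J - 1) * d" using J by (cases J) auto
      then have "c - 1 < d ^ (J - 1) * d" using c2 by linarith
      then show ?thesis using less_mult_imp_div_less by (auto simp: p_def Suc_le_eq)
    qed
    moreover have "c = d * (p - 1) + ((c - 1) mod d + 1)" "(c - 1) mod d < d"
      using c2 d by (simp_all add: p_def)
    moreover have "d * p = d * (p - 1) + d" "1 \<le> p" by (simp_all add: p_def)
    ultimately have "c \<in> children d J p" using c2(1) unfolding children_def by auto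
    then show ?thesis using \<open>p \<in> A\<close> by blast
  qed
  ultimately show "A \<in> rooted_trees d J k" by (auto simp: rooted_trees_def A_def)
qed

section \<open>Second pass\<close>

text \<open>No child coincides with \<open>i\<close>, so the size stored at \<open>i\<close> is
  unchanged and all ranks consult the same row of \<open>G\<close>. Subtracting
  \<open>d * (i - 1)\<close> recovers the rank from the child.\<close>

lemma fold_backtrack_step:
  fixes st :: etp_state
  assumes "\<forall>r\<in>set rs. d * (i - 1) + r \<noteq> i"
  defines "S \<equiv> \<lambda>rs. (\<lambda>r. d * (i - 1) + r) ` {r \<in> set rs. 0 < tabG st i (Gam st i) r}"
  shows "tabF (fold (backtrack_step d i) rs st) = tabF st \<and>
    tabG (fold (backtrack_step d i) rs st) = tabG st \<and>
    tau (fold (backtrack_step d i) rs st) = (\<lambda>x. if x \<in> S rs then 1 else tau st x) \<and>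
    Gam (fold (backtrack_step d i) rs st) =
      (\<lambda>x. if x \<in> S rs then tabG st i (Gam st i) (x - d * (i - 1)) else Gam st x) \<and>
    ops (fold (backtrack_step d i) rs st) = ops st + length rs"
  using assms(1)
proof (induction rs rule: rev_induct)
  case (snoc r rs)
  define st' where "st' = fold (backtrack_step d i) rs st"
  define g where "g = tabG st i (Gam st i) r"
  have IH: "tabF st' = tabF st" "tabG st' = tabG st"
    "tau st' = (\<lambda>x. if x \<in> S rs then 1 else tau st x)"
    "Gam st' = (\<lambda>x. if x \<in> S rs then tabG st i (Gam st i) (x - d * (i - 1)) else Gam st x)"
    "ops st' = ops st + length rs"
    using snoc unfolding st'_def by simp_all
  have "i \<notin> S rs" using snoc.prems by (auto simp: S_def)
  then have "tabG st' i (Gam st' i) r = g" by (simp add: IH g_def)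
  then have st'': "fold (backtrack_step d i) (rs @ [r]) st =
      (if 0 < g then st'\<lparr>ops := ops st' + 1, tau := (tau st')(d * (i - 1) + r := 1),
         Gam := (Gam st')(d * (i - 1) + r := g)\<rparr> else st'\<lparr>ops := ops st' + 1\<rparr>)"
    by (simp add: backtrack_step_def Let_def st'_def)
  have "S (rs @ [r]) = (if 0 < g then insert (d * (i - 1) + r) (S rs) else S rs)"
    by (auto simp: S_def g_def)
  then show ?case unfolding st'' by (auto simp: IH g_def)
qed (simp add: S_def)

definition backtrack_node :: "nat \<Rightarrow> nat \<Rightarrow> etp_state \<Rightarrow> etp_state" where
  "backtrack_node d i st =
     (if tau st i = 1 then fold (backtrack_step d i) [(if i = 1 then 2 else 1)..<d + 1] st else st)"

text \<open>The levels \<open>0..J-1\<close> in order list the nodes \<open>1..d ^ (J - 1)\<close>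
  consecutively, so the nested loops become one, suited to induction on the node number.\<close>

lemma second_pass_eq:
  assumes d: "d \<ge> 2" and J: "J \<ge> 1"
  shows "second_pass d J k st = fold (backtrack_node d) [1..<d ^ (J - 1) + 1]
     (st\<lparr>tau := (\<lambda>_. 0)(1 := 1), Gam := (Gam st)(1 := k)\<rparr>)"
proof -
  define B where "B = (\<lambda>j. fold (\<lambda>i st. if tau st i = 1
      then fold (backtrack_step d i) [max 1 (2 - j)..<d + 1] st else st) (level_nodes d j))"
  have B: "B j st = fold (backtrack_node d) (level_nodes d j) st" for j st
    unfolding B_def
  proof (intro List.fold_cong refl)
    fix i assume i: "i \<in> set (level_nodes d j)"
    have "max 1 (2 - j) = (if i = 1 then 2 else 1)"
      using i d by (cases "j = 0") (auto simp: level_nodes_def)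
    then show "(\<lambda>st. if tau st i = 1 then fold (backtrack_step d i) [max 1 (2 - j)..<d + 1] st else st) =
        backtrack_node d i" by (simp add: backtrack_node_def fun_eq_iff)
  qed
  have "fold B [0..<Suc t] st = fold (backtrack_node d) [1..<d ^ t + 1] st" for t st
  proof (induction t)
    case 0
    then show ?case by (simp add: B level_nodes_def)
  next
    case (Suc t)
    have "[1..<d ^ Suc t + 1] = [1..<d ^ t + 1] @ level_nodes d (Suc t)"
      using d upt_add_eq_append[of 1 "d ^ t + 1" "d ^ Suc t - d ^ t"] by (simp add: level_nodes_def)
    moreover have "fold B [0..<Suc (Suc t)] st = B (Suc t) (fold B [0..<Suc t] st)"
      by simp
    ultimately show ?case using Suc by (simp only: B[of "Suc t"] fold_append o_apply)
  qed
  from this[of "J - 1"] show ?thesis using J by (simp add: second_pass_def B_def)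
qed

lemma second_pass:
  assumes d: "d \<ge> 2" and J: "J \<ge> 1" and k: "k \<ge> 1"
  shows "c \<in> {1..d ^ J} \<Longrightarrow>
      tau (second_pass d J k st) c = (if 0 < subtree_size d k (tabG st) c then 1 else 0)"
    and "ops (second_pass d J k st) \<le> ops st + d ^ J"
proof -
  define sz where "sz = subtree_size d k (tabG st)"
  define st0 where "st0 = st\<lparr>tau := (\<lambda>_. 0)(1 := 1), Gam := (Gam st)(1 := k)\<rparr>"
  \<comment> \<open>After the nodes \<open>1..n\<close> the marks are final up to
    \<open>d * n\<close>, the last of their children, and still 0 beyond; \<open>max 1\<close>
    accounts for the root, marked before the loop. \<open>Gam\<close> is constrained only at marked
    nodes, as it holds leftover memory elsewhere.\<close>
  have inv: "tabG (fold (backtrack_node d) [1..<n + 1] st0) = tabG st \<and>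
    (\<forall>c\<in>{1..max 1 (d * n)}. tau (fold (backtrack_node d) [1..<n + 1] st0) c = (if 0 < sz c then 1 else 0) \<and>
       (0 < sz c \<longrightarrow> Gam (fold (backtrack_node d) [1..<n + 1] st0) c = sz c)) \<and>
    (\<forall>c>max 1 (d * n). tau (fold (backtrack_node d) [1..<n + 1] st0) c = 0) \<and>
    ops (fold (backtrack_node d) [1..<n + 1] st0) \<le> ops st + d * n" for n
  proof (induction n)
    case 0
    then show ?case using k by (simp add: st0_def sz_def subtree_size_root[simplified])
  next
    case (Suc n)
    define i where "i = n + 1"
    define st1 where "st1 = fold (backtrack_node d) [1..<n + 1] st0"
    define st2 where "st2 = fold (backtrack_node d) [1..<Suc n + 1] st0"
    have st2: "st2 = backtrack_node d i st1" by (simp add: st2_def st1_def i_def)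
    have IH: "tabG st1 = tabG st"
      "\<And>c. 1 \<le> c \<Longrightarrow> c \<le> max 1 (d * n) \<Longrightarrow> tau st1 c = (if 0 < sz c then 1 else 0) \<and> (0 < sz c \<longrightarrow> Gam st1 c = sz c)"
      "\<And>c. c > max 1 (d * n) \<Longrightarrow> tau st1 c = 0" "ops st1 \<le> ops st + d * n"
      using Suc.IH by (auto simp: st1_def)
    have dn: "2 * n \<le> d * n" using d by simp
    \<comment> \<open>The node handled next has already received its final mark.\<close>
    then have "n = 0 \<or> n + 1 \<le> d * n" by linarith
    then have i: "1 \<le> i" "i \<le> max 1 (d * n)" by (auto simp: i_def)
    note IHi = IH(2)[OF this]
    have mx: "max 1 (d * Suc n) = d * n + d" using d by simp
    have ch: "\<exists>r\<in>ranks d i. c = d * (i - 1) + r" if "c > max 1 (d * n)" "c \<le> d * n + d" for c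
    proof (intro bexI[of _ "c - d * n"])
      show "c - d * n \<in> ranks d i" using that by (auto simp: ranks_def i_def)
    qed (use that in \<open>auto simp: i_def\<close>)
    have szc: "sz (d * (i - 1) + r) = (if sz i = 0 then 0 else tabG st i (sz i) r)" if "r \<in> ranks d i" for r
      unfolding sz_def by (rule subtree_size_child[OF d i(1) that])
    have "tabG st2 = tabG st \<and>
      (\<forall>c\<in>{1..d * n + d}. tau st2 c = (if 0 < sz c then 1 else 0) \<and> (0 < sz c \<longrightarrow> Gam st2 c = sz c)) \<and>
      (\<forall>c>d * n + d. tau st2 c = 0) \<and> ops st2 \<le> ops st + d * Suc n"
    proof (cases "sz i = 0")
      case True
      then have e: "st2 = st1" using IHi by (simp add: st2 backtrack_node_def)
      have "tau st1 c = (if 0 < sz c then 1 else 0) \<and> (0 < sz c \<longrightarrow> Gam st1 c = sz c)"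
        if c: "1 \<le> c" "c \<le> d * n + d" for c
      proof (cases "c \<le> max 1 (d * n)")
        case True
        then show ?thesis using IH(2) c by blast
      next
        case False
        then have "c > max 1 (d * n)" by (simp only: not_le)
        from ch[OF this c(2)] obtain r where "r \<in> ranks d i" "c = d * (i - 1) + r" by blast
        then have "sz c = 0" using szc \<open>sz i = 0\<close> by simp
        then show ?thesis using IH(3)[OF \<open>c > max 1 (d * n)\<close>] by simp
      qed
      then show ?thesis using IH d unfolding e by auto
    next
      case False
      define rs where "rs = [(if i = 1 then 2 else 1)..<d + 1]"
      have rs: "set rs = ranks d i" by (auto simp: rs_def ranks_def)
      have G: "Gam st1 i = sz i" "tau st1 i = 1" using False IHi by auto
      have e: "st2 = fold (backtrack_step d i) rs st1" using G by (simp add: st2 backtrack_node_def rs_def)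
      define S where "S = (\<lambda>r. d * (i - 1) + r) ` {r \<in> ranks d i. 0 < tabG st i (sz i) r}"
      have "\<forall>r\<in>set rs. d * (i - 1) + r \<noteq> i" unfolding rs by (metis less_child[OF d _ i(1)] less_irrefl)
      note fb = fold_backtrack_step[OF this, of st1, folded e, unfolded rs G IH(1), folded S_def]
      have lo: "max 1 (d * n) < d * (i - 1) + r" "d * (i - 1) + r \<le> d * n + d" if "r \<in> ranks d i" for r
        using less_child[OF d that i(1)] that by (auto simp: ranks_def i_def split: if_splits)
      have Sc: "max 1 (d * n) < c \<and> c \<le> d * n + d" if "c \<in> S" for c using that lo by (auto simp: S_def)
      have "tau st2 c = (if 0 < sz c then 1 else 0) \<and> (0 < sz c \<longrightarrow> Gam st2 c = sz c)"
        if c: "1 \<le> c" "c \<le> d * n + d" for c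
      proof (cases "c \<le> max 1 (d * n)")
        case True
        then have "c \<notin> S" using Sc[of c] by auto
        then show ?thesis using IH(2)[of c] True c fb by simp
      next
        case False
        then have "c > max 1 (d * n)" by (simp only: not_le)
        from ch[OF this c(2)] obtain r where r: "r \<in> ranks d i" "c = d * (i - 1) + r" by blast
        then have s: "sz c = tabG st i (sz i) r" using szc \<open>sz i \<noteq> 0\<close> by simp
        then have "c \<in> S \<longleftrightarrow> 0 < sz c" using r by (auto simp: S_def)
        then show ?thesis using IH(3)[OF \<open>c > max 1 (d * n)\<close>] fb s r by auto
      qed
      moreover have "tau st2 c = 0" if "c > d * n + d" for c
      proof -
        have "c \<notin> S" using Sc[of c] that by auto
        moreover have "c > max 1 (d * n)" using that d by auto
        ultimately show ?thesis using IH(3)[of c] fb by simp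
      qed
      moreover have "ops st2 \<le> ops st + d * Suc n" using fb IH(4) by (auto simp: rs_def)
      ultimately show ?thesis using fb by auto
    qed
    then show ?case unfolding mx st2_def by blast
  qed
  have J': "d ^ J = d * d ^ (J - 1)" using J by (cases J) auto
  have "max 1 (d * d ^ (J - 1)) = d * d ^ (J - 1)" using d by (simp add: max_def)
  note inv' = inv[of "d ^ (J - 1)", unfolded this, folded J' second_pass_eq[OF d J, of k st, folded st0_def]]
  show "c \<in> {1..d ^ J} \<Longrightarrow>
      tau (second_pass d J k st) c = (if 0 < subtree_size d k (tabG st) c then 1 else 0)"
    using inv' by (simp add: sz_def)
  show "ops (second_pass d J k st) \<le> ops st + d ^ J" using inv' by simp
qed


section \<open>Operation count\<close>

lemma geometric_sum_le: "d \<ge> 2 \<Longrightarrow> (\<Sum>i<Suc n. d ^ i) \<le> 2 * d ^ n" for d :: nat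
proof (induction n)
  case (Suc n)
  have "2 * d ^ n \<le> d * d ^ n" using Suc.prems by (intro mult_le_mono1)
  then show ?case using Suc.IH[OF Suc.prems] unfolding sum.lessThan_Suc[of _ "Suc n"] power_Suc by linarith
qed simp

text \<open>Multiplying by \<open>d\<close> avoids the exponent \<open>j - 1\<close>; the factor is
  available in the cost of a level.\<close>

lemma length_level_nodes: "j \<ge> 1 \<Longrightarrow> length (level_nodes d j) * d = (d - 1) * d ^ j"
  by (cases j; cases d) (auto simp: level_nodes_def algebra_simps simp del: upt_Suc)

text \<open>
  On levels with \<open>d ^ j * k \<le> d ^ (J + 1)\<close> the bound \<open>l(j) \<le> k\<close> is used, and below them the bound
  of \<open>l(j)\<close> by the size of the subtree; both partial sums are geometric, dominated by the term at
  the threshold level.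
\<close>

lemma first_pass_cost:
  assumes d: "d \<ge> 2" and k: "2 \<le> k" "k \<le> d ^ J"
  shows "(d - 1) * k\<^sup>2 + (\<Sum>j\<in>{1..<J}. length (level_nodes d j) * (d * (ell d J k j)\<^sup>2)) \<le>
    3 * d\<^sup>2 * d ^ J * k"
proof -
  define D where "D = d ^ (J + 1)"
  define e where "e = (\<lambda>j. (d - 1) * d ^ j * (ell d J k j)\<^sup>2)"
  have top: "(\<Sum>j\<in>{1..<Suc t}. e j) \<le> d ^ Suc t * k\<^sup>2" for t
  proof (induction t)
    case (Suc t)
    have "e (Suc t) \<le> (d - 1) * d ^ Suc t * k\<^sup>2"
      unfolding e_def by (intro mult_le_mono2 power_mono) (auto simp: ell_def)
    also have "\<dots> + d ^ Suc t * k\<^sup>2 = d ^ Suc (Suc t) * k\<^sup>2"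
      using d by (cases d) (auto simp: algebra_simps)
    finally show ?case using Suc by simp
  qed simp
  have bottom: "(\<Sum>j\<in>{t..<J}. e j) \<le> 2 * D * d ^ (J + 1 - t)" if "t \<le> J" for t
    using that
  proof (induction t rule: inc_induct)
    case (step n)
    define S where "S = (\<Sum>t<J + 1 - n. d ^ t)"
    have "d ^ (J + 1 - n) = (d - 1) * S + 1" unfolding S_def by (rule power_eq_geometric_sum[OF d])
    then have S: "(d - 1) * S \<le> d ^ (J + 1 - n)" by simp
    have S': "S \<le> 2 * d ^ (J - n)" using geometric_sum_le[OF d, of "J - n"] step by (simp add: S_def Suc_diff_le)
    have l: "ell d J k n \<le> S" by (simp add: ell_eq[OF d] S_def)
    then have "(ell d J k n)\<^sup>2 \<le> S\<^sup>2" by (rule power_mono) simp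
    then have "e n \<le> (d - 1) * d ^ n * S\<^sup>2" unfolding e_def by (rule mult_le_mono2)
    also have "\<dots> = d ^ n * ((d - 1) * S) * S" by (simp add: power2_eq_square ac_simps)
    also have "\<dots> \<le> d ^ n * d ^ (J + 1 - n) * (2 * d ^ (J - n))"
      by (intro mult_le_mono S S' order_refl)
    also have "d ^ n * d ^ (J + 1 - n) = D" using step by (simp add: D_def flip: power_add)
    \<comment> \<open>The factor \<open>d - 1\<close> is inserted so that the induction telescopes:
      \<open>(d - 1) * x + x = d * x\<close>.\<close>
    also have "D * (2 * d ^ (J - n)) \<le> (d - 1) * (D * (2 * d ^ (J - n)))"
    proof -
      have "1 \<le> d - 1" using d by linarith
      from mult_le_mono1[OF this] show ?thesis by (simp only: mult_1)
    qed
    finally have "e n \<le> (d - 1) * (2 * D * d ^ (J - n))" by (simp add: ac_simps)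
    moreover have "(d - 1) * (2 * D * d ^ (J - n)) + 2 * D * d ^ (J - n) = 2 * D * d ^ (J + 1 - n)"
      using d step by (cases d) (auto simp: algebra_simps Suc_diff_le)
    ultimately show ?case using step by (simp add: sum.atLeast_Suc_lessThan)
  qed simp
  \<comment> \<open>The first level beyond the threshold. It exists since \<open>J + 1\<close>
    qualifies and is positive since \<open>k <= D\<close>, so its predecessor satisfies the opposite
    inequality.\<close>
  define t where "t = (LEAST t. D < d ^ t * k)"
  have "D < d ^ (J + 1) * k" using k d by (simp add: D_def)
  then have t: "D < d ^ t * k" "t \<le> J + 1" unfolding t_def by (rule LeastI, rule Least_le)
  have "k \<le> D" using k(2) d unfolding D_def
    by (metis (no_types) le_add1 le_trans not_numeral_le_zero power_increasing One_nat_def Suc_leI neq0_conv)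
  moreover have "D < k" if "t = 0" using t(1) that by simp
  ultimately have "t \<noteq> 0" by linarith
  then obtain t' where t': "t = Suc t'" by (cases t) auto
  have "\<not> D < d ^ t' * k" using not_less_Least[of t' "\<lambda>t. D < d ^ t * k"] t' by (simp add: t_def)
  then have "d ^ t * k\<^sup>2 \<le> d * k * D"
    using t' mult_le_mono2[of "d ^ t' * k" D "d * k"] by (simp add: power2_eq_square ac_simps)
  then have T: "(\<Sum>j\<in>{1..<t}. e j) \<le> d * k * D"
    using top[of t'] unfolding t' by (rule order_trans[rotated])
  have B: "(\<Sum>j\<in>{t..<J}. e j) \<le> 2 * D * k"
  proof (cases "t \<le> J")
    case True
    have "d ^ t * d ^ (J + 1 - t) < d ^ t * k" using t by (simp add: D_def flip: power_add)
    then have "d ^ (J + 1 - t) \<le> k" by simp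
    then have "2 * D * d ^ (J + 1 - t) \<le> 2 * D * k" by (rule mult_le_mono2)
    then show ?thesis using bottom[OF True] by linarith
  qed simp
  have "length (level_nodes d j) * (d * (ell d J k j)\<^sup>2) = e j" if "j \<ge> 1" for j
    using length_level_nodes[OF that, of d] by (simp add: e_def flip: mult.assoc)
  then have "(\<Sum>j\<in>{1..<J}. length (level_nodes d j) * (d * (ell d J k j)\<^sup>2)) = (\<Sum>j\<in>{1..<J}. e j)"
    by (intro sum.cong) auto
  also have "\<dots> \<le> (\<Sum>j\<in>{1..<t} \<union> {t..<J}. e j)" by (intro sum_mono2) auto
  also have "\<dots> \<le> (\<Sum>j\<in>{1..<t}. e j) + (\<Sum>j\<in>{t..<J}. e j)" by (subst sum.union_disjoint) auto
  also have "\<dots> \<le> d * k * D + 2 * D * k" using T B by linarith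
  also have "\<dots> \<le> 2 * (d\<^sup>2 * d ^ J * k)"
  proof -
    have "2 * (D * k) \<le> d * (D * k)" using d by (intro mult_le_mono1)
    then show ?thesis by (simp add: D_def power2_eq_square ac_simps)
  qed
  also have "(d - 1) * k\<^sup>2 + 2 * (d\<^sup>2 * d ^ J * k) \<le> 3 * d\<^sup>2 * d ^ J * k"
  proof -
    have "(d - 1) * k\<^sup>2 \<le> d\<^sup>2 * (d ^ J * k)"
      unfolding power2_eq_square[of k] using k(2) d
      by (intro mult_le_mono) (auto simp: power2_eq_square intro: le_trans[OF diff_le_self])
    then show ?thesis by (simp add: ac_simps)
  qed
  finally show ?thesis by simp
qed

section \<open>Tree projection\<close>

text \<open>A vector supported on \<open>B\<close> pays the full energy of \<open>y\<close> outside
  \<open>B\<close>, while \<open>z\<close> pays exactly the energy outside \<open>A\<close>.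
  Minimizing the error thus means maximizing the energy kept.\<close>

lemma restriction_is_tree_projection:
  assumes A: "A \<in> rooted_trees d J k"
    and opt: "\<And>B. B \<in> rooted_trees d J k \<Longrightarrow> (\<Sum>x\<in>B. (y x)\<^sup>2) \<le> (\<Sum>x\<in>A. (y x)\<^sup>2)"
    and z: "\<And>i. i \<in> {1..d ^ J} \<Longrightarrow> z i = (if i \<in> A then y i else 0)"
  shows "is_tree_projection d J k y z"
proof -
  let ?N = "{1..d ^ J}"
  have compl: "(\<Sum>i\<in>?N - B. (y i)\<^sup>2) = (\<Sum>i\<in>?N. (y i)\<^sup>2) - (\<Sum>i\<in>B. (y i)\<^sup>2)"
    if "B \<in> rooted_trees d J k" for B
    using that by (intro sum_diff) (auto simp: rooted_trees_def)
  have "tree_supported d J k z"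
    unfolding tree_supported_def using A z by (intro bexI[of _ A]) auto
  moreover have "L2_set (\<lambda>i. z i - y i) ?N \<le> L2_set (\<lambda>i. x i - y i) ?N"
    if "tree_supported d J k x" for x
  proof -
    obtain B where B: "B \<in> rooted_trees d J k" "\<forall>i\<in>?N. i \<notin> B \<longrightarrow> x i = 0"
      using \<open>tree_supported d J k x\<close> by (auto simp: tree_supported_def)
    have "(\<Sum>i\<in>?N. (z i - y i)\<^sup>2) = (\<Sum>i\<in>?N - A. (y i)\<^sup>2)"
      using z by (intro sum.mono_neutral_cong_right) auto
    also have "\<dots> \<le> (\<Sum>i\<in>?N - B. (y i)\<^sup>2)" using compl[OF A] compl[OF B(1)] opt[OF B(1)] by simp
    also have "\<dots> = (\<Sum>i\<in>?N - B. (x i - y i)\<^sup>2)" using B(2) by (intro sum.cong) auto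
    also have "\<dots> \<le> (\<Sum>i\<in>?N. (x i - y i)\<^sup>2)" by (intro sum_mono2) auto
    finally show ?thesis by (simp add: L2_set_def)
  qed
  ultimately show ?thesis by (auto simp: is_tree_projection_def is_arg_min_def not_less)
qed

theorem theorem2:
  fixes d J N k :: nat and y :: "nat \<Rightarrow> real" and pick :: choice and st :: etp_state
  assumes "d \<ge> 2" and "J \<ge> 2" and "N = d ^ J" and "2 \<le> k" and "k \<le> N"
    and "valid_choice pick"
  shows "is_tree_projection d J k y (etp_output d J k y pick st) \<and>
         etp_ops d J k y pick st \<le> 3 * d\<^sup>2 * N * k + N"
proof
  define st1 where "st1 = first_pass d J k y pick (st\<lparr>ops := 0\<rparr>)"
  have J: "1 \<le> J" and k: "1 \<le> k" "k \<le> d ^ J" using assms by auto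
  have run: "etp_run d J k y pick st = second_pass d J k st1" by (simp add: etp_run_def st1_def)
  note fp = first_pass[OF assms(1) J k(2) assms(6), of y "st\<lparr>ops := 0\<rparr>", folded st1_def]
  define A where "A = {c \<in> {1..d ^ J}. 0 < subtree_size d k (tabG st1) c}"
  note bt = backtracked_tree[OF assms(1) J k fp(1), folded A_def]
  show "is_tree_projection d J k y (etp_output d J k y pick st)"
  proof (rule restriction_is_tree_projection[OF bt(1)])
    show "(\<Sum>x\<in>B. (y x)\<^sup>2) \<le> (\<Sum>x\<in>A. (y x)\<^sup>2)" if "B \<in> rooted_trees d J k" for B
      using rooted_tree_weight_le[OF assms(1) J k(2) fp(1) that] bt(2) by simp
    show "etp_output d J k y pick st i = (if i \<in> A then y i else 0)" if "i \<in> {1..d ^ J}" for i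
      using second_pass(1)[OF assms(1) J k(1) that, of st1] that
      by (auto simp: etp_output_def run A_def)
  qed
  have "etp_ops d J k y pick st \<le> ops st1 + N"
    using second_pass(2)[OF assms(1) J k(1), of st1] assms(3) by (simp add: etp_ops_def run)
  also have "ops st1 \<le> 3 * d\<^sup>2 * d ^ J * k"
    using fp(2) first_pass_cost[OF assms(1,4) k(2)] by simp
  finally show "etp_ops d J k y pick st \<le> 3 * d\<^sup>2 * N * k + N" using assms(3) by simp
qed

end
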